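(* Let $n\geq 2$, let $k$ be a nonnegative integer, let $f:\mathbb{S}^{n-1}\to\mathbb{R}$ be an even continuous function, and suppose that $$H(x)=\int_{\mathbb{S}^{n-1}}|\langle x,\xi\rangle|^{2k+1}f(\xi)\,d\xi,\qquad x\in\mathbb{R}^n.$$ Then $H\in C^{2k+2}(\mathbb{R}^n\setminus\{0\})$, and for every multi-index $\alpha=(\alpha_1,\dots,\alpha_n)$ with $|\alpha|=2k+2$ and every $x\in\mathbb{R}^n\setminus\{0\}$, $$D^{\alpha}H(x)=C_{2k+1}\,\frac{(-1)^{k+1}}{\|x\|}\int_{\mathbb{S}^{n-1}\cap x^{\perp}}\xi_1^{\alpha_1}\cdots\xi_n^{\alpha_n}f(\xi)\,d\xi .$$
   Context: $\mathbb{S}^{n-1}$ is the Euclidean unit sphere in $\mathbb{R}^n$, $\langle\cdot,\cdot\rangle$ the standard scalar product, $\|\cdot\|$ the Euclidean norm, and $x^{\perp}$ the $(n-1)$-dimensional subspace orthogonal to $x$. In integrals over $\mathbb{S}^{n-1}$, $d\xi$ is the (unnormalized) spherical Lebesgue measure; in integrals over $\mathbb{S}^{n-1}\cap x^{\perp}$, $d\xi$ is the (unnormalized) spherical Lebesgue measure of this $(n-2)$-dimensional unit sphere (for $n=2$, counting measure on its two points). A function $f$ on the sphere is even if $f(-\xi)=f(\xi)$. For a multi-index $\alpha=(\alpha_1,\dots,\alpha_n)$ of nonnegative integers, $|\alpha|=\alpha_1+\cdots+\alpha_n$ and $D^{\alpha}=(\partial/\partial x_1)^{\alpha_1}\cdots(\partial/\partial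 x_n)^{\alpha_n}$. The constants are $$C_t=\frac{2^{t+1}\sqrt{\pi}\,\Gamma((t+1)/2)}{\Gamma(-t/2)}.$$ *)

theory Defs
  imports "HOL-Analysis.Analysis"
begin

section \<open>Spherical Lebesgue measure\<close>

definition orthonormal_basis_of :: "'a::euclidean_space set \<Rightarrow> 'a set \<Rightarrow> bool" where
  "orthonormal_basis_of V B \<longleftrightarrow>
     finite B \<and> pairwise orthogonal B \<and> (\<forall>b\<in>B. norm b = 1) \<and> span B = V"

text \<open>
  The \<open>dim V\<close>-dimensional Lebesgue measure carried by a linear subspace \<open>V\<close>, built as \<open>lborel\<close> is in
  the library: the product of one-dimensional Lebesgue measures in coordinates with respect to an
  orthonormal basis of \<open>V\<close>. By orthogonal invariance the choice of the basis is immaterial.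
\<close>

definition subspace_lborel :: "'a::euclidean_space set \<Rightarrow> 'a measure" where
  "subspace_lborel V =
     (let B = (SOME B. orthonormal_basis_of V B)
      in distr (\<Pi>\<^sub>M b\<in>B. lborel) borel (\<lambda>c. \<Sum>b\<in>B. c b *\<^sub>R b))"

text \<open>
  The unnormalized spherical Lebesgue measure \<open>\<sigma>\<close> on the unit sphere of a \<open>d\<close>-dimensional subspace
  \<open>V\<close>, obtained from the cone formula: \<open>\<sigma>(A)\<close> is \<open>d\<close> times the volume of
  \<open>{y \<in> V. 0 < \<parallel>y\<parallel> \<le> 1 \<and> y / \<parallel>y\<parallel> \<in> A}\<close>. Its total mass is \<open>d\<close> times the volume of the unit ball, and
  for \<open>d = 1\<close> it is the counting measure on the two unit vectors of \<open>V\<close>. The underlying space of the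
  measure is the sphere itself, so integrands only matter there.
\<close>

definition sphere_measure :: "'a::euclidean_space set \<Rightarrow> 'a measure" where
  "sphere_measure V =
     distr (scale_measure (of_nat (dim V))
              (restrict_space (subspace_lborel V) (V \<inter> cball 0 1 - {0})))
           (restrict_space borel (V \<inter> sphere 0 1))
           (\<lambda>y. y /\<^sub>R norm y)"

lemma orthonormal_basis_of_exists:
  assumes "subspace V"
  shows "\<exists>B. orthonormal_basis_of V B"
  using orthonormal_basis_subspace[OF assms] independent_imp_finite
  unfolding orthonormal_basis_of_def by metis

lemma distr_orthogonal_lborel:
  fixes T :: "real^'n::{finite,wellorder} \<Rightarrow> real^'n::_"
  assumes T: "orthogonal_transformation T"
  shows "distr lborel borel T = lborel"
proof (rule lborel_eqI[symmetric])
  have lin: "linear T" using T by (rule orthogonal_transformation_linear)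
  have bij: "bij T" using T by (rule orthogonal_transformation_bij)
  have inv: "orthogonal_transformation (inv T)" using T by (rule orthogonal_transformation_inv)
  have meas: "T \<in> borel_measurable borel"
    by (intro borel_measurable_continuous_onI linear_continuous_on linear_linear[THEN iffD2] lin)
  fix l u :: "real^'n::_" assume le: "\<And>b. b \<in> Basis \<Longrightarrow> l \<bullet> b \<le> u \<bullet> b"
  have pre: "T -` box l u = inv T ` box l u"
    using bij by (simp add: bij_vimage_eq_inv_image)
  have fm: "inv T ` box l u \<in> lmeasurable"
    by (rule measurable_orthogonal_image[OF inv]) simp
  have bo: "inv T ` box l u \<in> sets borel"
    using measurable_sets[OF meas, of "box l u"] pre by simp
  have "emeasure (distr lborel borel T) (box l u) = emeasure lborel (inv T ` box l u)"
    using meas by (simp add: emeasure_distr pre)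
  also have "\<dots> = emeasure lebesgue (inv T ` box l u)"
    using bo by simp
  also have "\<dots> = ennreal (measure lebesgue (inv T ` box l u))"
    using fm by (rule emeasure_eq_measure2)
  also have "\<dots> = ennreal (measure lebesgue (box l u))"
    by (subst measure_orthogonal_image[OF inv]) auto
  also have "\<dots> = ennreal (\<Prod>b\<in>Basis. (u - l) \<bullet> b)"
    using le by (simp add: measure_lborel_box_eq)
  finally show "emeasure (distr lborel borel T) (box l u) = ennreal (\<Prod>b\<in>Basis. (u - l) \<bullet> b)" .
qed simp

lemma subspace_lborel_UNIV:
  "subspace_lborel UNIV = (lborel :: (real^'n::{finite,wellorder}) measure)"
proof -
  define B where "B = (SOME B :: (real^'n::_) set. orthonormal_basis_of UNIV B)"
  have "orthonormal_basis_of UNIV B"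
    unfolding B_def by (rule someI_ex, rule orthonormal_basis_of_exists) simp
  then have fin: "finite B" and orth: "pairwise orthogonal B"
    and nrm: "\<And>b. b \<in> B \<Longrightarrow> norm b = 1" and span: "span B = UNIV"
    by (auto simp: orthonormal_basis_of_def)
  have "independent B"
    using orth nrm by (intro pairwise_orthogonal_independent) (auto, force)
  then have "card B = DIM(real^'n::_)"
    using span by (metis dim_UNIV dim_span dim_eq_card_independent)
  then obtain p where p: "bij_betw p (Basis :: (real^'n::_) set) B"
    using fin by (metis finite_Basis finite_same_card_bij)
  define T where "T x = (\<Sum>i\<in>Basis. (x \<bullet> i) *\<^sub>R p i)" for x :: "real^'n::_"
  define S where "S c = (\<Sum>i\<in>Basis. c (p i) *\<^sub>R i)" for c :: "real^'n::_ \<Rightarrow> real"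
  have pB: "p i \<in> B" if "i \<in> Basis" for i using p that by (auto simp: bij_betw_def)
  have pp: "p i \<bullet> p j = (if i = j then 1 else 0)" if "i \<in> Basis" "j \<in> Basis" for i j
  proof (cases "i = j")
    case True
    then show ?thesis using nrm[OF pB[OF that(1)]] by (simp add: dot_square_norm)
  next
    case False
    then have "p i \<noteq> p j" using p that by (auto simp: bij_betw_def inj_on_def)
    then show ?thesis using orth pB that False by (auto simp: pairwise_def orthogonal_def)
  qed
  have lin: "linear T" unfolding T_def
    by (intro linear_compose_sum ballI linearI) (auto simp: inner_simps algebra_simps)
  have "T x \<bullet> T y = x \<bullet> y" for x y
  proof -
    have "T x \<bullet> T y = (\<Sum>j\<in>Basis. \<Sum>i\<in>Basis. (x \<bullet> i) * (y \<bullet> j) * (p i \<bullet> p j))"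
      by (simp add: T_def inner_sum_left inner_sum_right sum_distrib_left mult_ac)
    also have "\<dots> = (\<Sum>j\<in>Basis. \<Sum>i\<in>Basis. if i = j then (x \<bullet> i) * (y \<bullet> j) else 0)"
      by (intro sum.cong) (auto simp: pp)
    also have "\<dots> = x \<bullet> y"
      by (simp add: euclidean_inner[of x y])
    finally show ?thesis .
  qed
  then have T: "orthogonal_transformation T"
    using lin by (simp add: orthogonal_transformation_def)
  have Tm: "T \<in> borel_measurable borel"
    by (intro borel_measurable_continuous_onI linear_continuous_on linear_linear[THEN iffD2] lin)
  have Sm: "S \<in> borel_measurable (\<Pi>\<^sub>M b\<in>B. lborel)"
    unfolding S_def
    by (intro borel_measurable_sum borel_measurable_scaleR)
       (auto intro!: measurable_component_singleton[THEN measurable_compose] simp: pB)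
  interpret product_sigma_finite "\<lambda>b :: real^'n::_. lborel :: real measure" ..
  have eq: "lborel = distr (\<Pi>\<^sub>M b\<in>B. lborel) borel S"
  proof (rule lborel_eqI)
    fix l u :: "real^'n::_" assume le: "\<And>b. b \<in> Basis \<Longrightarrow> l \<bullet> b \<le> u \<bullet> b"
    let ?q = "inv_into Basis p"
    have qp: "?q (p i) = i" if "i \<in> Basis" for i
      using p that by (simp add: bij_betw_def)
    have Si: "S c \<bullet> i = c (p i)" if "i \<in> Basis" for c i
      using that by (simp add: S_def inner_sum_left_Basis)
    have pre: "S -` box l u \<inter> space (\<Pi>\<^sub>M b\<in>B. lborel) = (\<Pi>\<^sub>E b\<in>B. {l \<bullet> ?q b <..< u \<bullet> ?q b})"
    proof -
      have "S c \<in> box l u \<longleftrightarrow> (\<forall>b\<in>B. c b \<in> {l \<bullet> ?q b <..< u \<bullet> ?q b})" for c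
        using p by (auto simp: mem_box Si bij_betw_def qp)
      then show ?thesis by (auto simp: space_PiM PiE_iff)
    qed
    have "emeasure (distr (\<Pi>\<^sub>M b\<in>B. lborel) borel S) (box l u)
        = (\<Prod>b\<in>B. emeasure lborel {l \<bullet> ?q b <..< u \<bullet> ?q b})"
      using Sm fin by (simp add: emeasure_distr pre emeasure_PiM)
    also have "\<dots> = (\<Prod>i\<in>Basis. emeasure lborel {l \<bullet> i <..< u \<bullet> i})"
      by (subst prod.reindex_bij_betw[OF p, symmetric]) (simp add: qp)
    also have "\<dots> = ennreal (\<Prod>i\<in>Basis. (u - l) \<bullet> i)"
      using le by (simp add: inner_diff_left prod_ennreal)
    finally show "emeasure (distr (\<Pi>\<^sub>M b\<in>B. lborel) borel S) (box l u)
        = ennreal (\<Prod>i\<in>Basis. (u - l) \<bullet> i)" .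
  qed simp
  have TS: "T (S c) = (\<Sum>b\<in>B. c b *\<^sub>R b)" for c
  proof -
    have "T (S c) = (\<Sum>i\<in>Basis. c (p i) *\<^sub>R p i)"
      by (simp add: T_def S_def inner_sum_left_Basis)
    also have "\<dots> = (\<Sum>b\<in>B. c b *\<^sub>R b)"
      by (rule sum.reindex_bij_betw[OF p])
    finally show ?thesis .
  qed
  have "subspace_lborel UNIV = distr (\<Pi>\<^sub>M b\<in>B. lborel) borel (T \<circ> S)"
    by (simp add: subspace_lborel_def Let_def B_def[symmetric] TS comp_def)
  also have "\<dots> = distr (distr (\<Pi>\<^sub>M b\<in>B. lborel) borel S) borel T"
    using Sm Tm by (simp add: distr_distr)
  also have "\<dots> = lborel"
    by (simp add: eq[symmetric] distr_orthogonal_lborel[OF T])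
  finally show ?thesis .
qed

section \<open>Partial derivatives and the classes \<open>C\<^sup>m\<close>\<close>

definition partial_deriv :: "'n::finite \<Rightarrow> (real^'n \<Rightarrow> real) \<Rightarrow> real^'n \<Rightarrow> real" where
  "partial_deriv i g x = deriv (\<lambda>t. g (x + t *\<^sub>R axis i 1)) 0"

text \<open>
  \<open>D\<^sup>\<alpha> g\<close> for a multi-index \<open>\<alpha>\<close>: the coordinates are taken in the order of the index type, the
  derivative in the last coordinate being applied first.
\<close>

definition multi_deriv :: "('n::{finite,linorder} \<Rightarrow> nat) \<Rightarrow> (real^'n::_ \<Rightarrow> real) \<Rightarrow> real^'n::_ \<Rightarrow> real" where
  "multi_deriv \<alpha> g = foldr (\<lambda>i. partial_deriv i ^^ \<alpha> i) (sorted_list_of_set UNIV) g"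

text \<open>
  \<open>Cm_on m U g\<close>, for open \<open>U\<close>: all iterated partial derivatives of \<open>g\<close> of order at most \<open>m\<close>, taken in
  any order of the coordinates, exist and are continuous on \<open>U\<close>.
\<close>

primrec Cm_on :: "nat \<Rightarrow> (real^'n::finite) set \<Rightarrow> (real^'n \<Rightarrow> real) \<Rightarrow> bool" where
  "Cm_on 0 U g \<longleftrightarrow> continuous_on U g"
| "Cm_on (Suc m) U g \<longleftrightarrow> continuous_on U g \<and>
     (\<forall>i. (\<forall>x\<in>U. (\<lambda>t. g (x + t *\<^sub>R axis i 1)) field_differentiable at 0) \<and>
          Cm_on m U (partial_deriv i g))"

section \<open>The constants \<open>C\<^sub>t\<close>\<close>

definition C_const :: "real \<Rightarrow> real" where
  "C_const t = 2 powr (t + 1) * sqrt pi * Gamma ((t + 1) / 2) / Gamma (- t / 2)"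

end

theory Submission
  imports Defs
begin

text \<open>
  Since \<open>\<bar>s\<bar>\<^sup>2\<^sup>k\<^sup>+\<^sup>1 = s\<^sup>2\<^sup>k\<^sup>+\<^sup>1 sgn s\<close>, the first \<open>2k+1\<close> derivatives are taken under the integral sign, by
  dominated convergence, because the hyperplane \<open>x \<bullet> \<xi> = 0\<close> is a null set of the sphere. This leaves
  \<open>(2k+1)! \<integral> sgn (x \<bullet> \<xi>) g \<xi> d\<xi>\<close> with \<open>g\<close> merely continuous. To differentiate it once more in
  direction \<open>v\<close>, pass from the sphere to the unit ball and split \<open>y = s u + z\<close> with \<open>u = x / \<parallel>x\<parallel>\<close> and
  \<open>z \<bottom> x\<close>. For fixed \<open>z\<close> the sign of \<open>(x + t v) \<bullet> y\<close> changes at a single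
  point \<open>s = a(t)\<close> with \<open>a'(0) = - (v \<bullet> z) / \<parallel>x\<parallel>\<close>, so the fundamental theorem of calculus in \<open>s\<close> yields
  an integral over the unit ball of \<open>x\<^sup>\<bottom>\<close>, which is turned back into one over its sphere. That integral
  depends continuously on \<open>x\<close> because the half turn about \<open>u + u'\<close> carries \<open>u\<^sup>\<bottom>\<close> to \<open>u'\<^sup>\<bottom>\<close>.
\<close>

section \<open>Lebesgue measure on hyperplanes\<close>

text \<open>An orthogonal map carries the standard basis to \<open>B\<close> and preserves
  \<open>lborel\<close>. Since \<open>subspace_lborel\<close> rests on a basis picked by
  \<open>SOME\<close>, this is what permits working in a basis adapted to a given unit
  vector.\<close>

lemma lborel_eq_orthonormal_basis:
  fixes B :: "(real^'n::{finite,wellorder}) set"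
  assumes "orthonormal_basis_of UNIV B"
  shows "lborel = distr (\<Pi>\<^sub>M b\<in>B. lborel) borel (\<lambda>c. \<Sum>b\<in>B. c b *\<^sub>R b)"
proof -
  have fin: "finite B" and orth: "pairwise orthogonal B"
    and nrm: "\<And>b. b \<in> B \<Longrightarrow> norm b = 1" and span: "span B = UNIV"
    using assms by (auto simp: orthonormal_basis_of_def)
  have "independent B"
    using orth nrm by (intro pairwise_orthogonal_independent) (auto, force)
  then have "card B = DIM(real^'n::_)"
    using span by (metis dim_UNIV dim_span dim_eq_card_independent)
  then obtain p where p: "bij_betw p (Basis :: (real^'n::_) set) B"
    using fin by (metis finite_Basis finite_same_card_bij)
  define T where "T x = (\<Sum>i\<in>Basis. (x \<bullet> i) *\<^sub>R p i)" for x :: "real^'n::_"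
  define S where "S c = (\<Sum>i\<in>Basis. c (p i) *\<^sub>R i)" for c :: "real^'n::_ \<Rightarrow> real"
  have pB: "p i \<in> B" if "i \<in> Basis" for i using p that by (auto simp: bij_betw_def)
  have lin: "linear T" unfolding T_def
    by (intro linear_compose_sum ballI linearI) (auto simp: inner_simps algebra_simps)
  have "(norm (T x))\<^sup>2 = (norm x)\<^sup>2" for x
  proof -
    have "pairwise (\<lambda>i j. orthogonal ((x \<bullet> i) *\<^sub>R p i) ((x \<bullet> j) *\<^sub>R p j)) Basis"
    proof (rule pairwiseI)
      fix i j :: "real^'n::_" assume ij: "i \<in> Basis" "j \<in> Basis" "i \<noteq> j"
      then have "p i \<noteq> p j" using p by (auto simp: bij_betw_def inj_on_def)
      then show "orthogonal ((x \<bullet> i) *\<^sub>R p i) ((x \<bullet> j) *\<^sub>R p j)"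
        using orth pB ij by (auto simp: pairwise_def orthogonal_def)
    qed
    then have "(norm (T x))\<^sup>2 = (\<Sum>i\<in>Basis. (norm ((x \<bullet> i) *\<^sub>R p i))\<^sup>2)"
      unfolding T_def by (intro norm_sum_Pythagorean) auto
    also have "\<dots> = (\<Sum>i\<in>Basis. (x \<bullet> i) * (x \<bullet> i))"
      by (intro sum.cong) (auto simp: nrm pB power2_eq_square)
    also have "\<dots> = (norm x)\<^sup>2"
      by (simp add: power2_norm_eq_inner euclidean_inner[of x x])
    finally show ?thesis .
  qed
  then have T: "orthogonal_transformation T"
    using lin by (simp add: orthogonal_transformation)
  have Tm: "T \<in> borel_measurable borel"
    by (intro borel_measurable_continuous_onI linear_continuous_on linear_linear[THEN iffD2] lin)
  have Sm: "S \<in> borel_measurable (\<Pi>\<^sub>M b\<in>B. lborel)"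
    unfolding S_def
    by (intro borel_measurable_sum borel_measurable_scaleR)
       (auto intro!: measurable_component_singleton[THEN measurable_compose] simp: pB)
  interpret product_sigma_finite "\<lambda>b :: real^'n::_. lborel :: real measure" ..
  have eq: "lborel = distr (\<Pi>\<^sub>M b\<in>B. lborel) borel S"
  proof (rule lborel_eqI)
    fix l u :: "real^'n::_" assume le: "\<And>b. b \<in> Basis \<Longrightarrow> l \<bullet> b \<le> u \<bullet> b"
    let ?q = "inv_into Basis p"
    have qp: "?q (p i) = i" if "i \<in> Basis" for i
      using p that by (simp add: bij_betw_def)
    have "S c \<in> box l u \<longleftrightarrow> (\<forall>b\<in>B. c b \<in> {l \<bullet> ?q b <..< u \<bullet> ?q b})" for c
      using p by (auto simp: mem_box S_def inner_sum_left_Basis bij_betw_def qp)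
    then have pre: "S -` box l u \<inter> space (\<Pi>\<^sub>M b\<in>B. lborel) = (\<Pi>\<^sub>E b\<in>B. {l \<bullet> ?q b <..< u \<bullet> ?q b})"
      by (auto simp: space_PiM PiE_iff)
    have "emeasure (distr (\<Pi>\<^sub>M b\<in>B. lborel) borel S) (box l u)
        = (\<Prod>b\<in>B. emeasure lborel {l \<bullet> ?q b <..< u \<bullet> ?q b})"
      using Sm fin by (simp add: emeasure_distr pre emeasure_PiM)
    also have "\<dots> = (\<Prod>i\<in>Basis. emeasure lborel {l \<bullet> i <..< u \<bullet> i})"
      by (subst prod.reindex_bij_betw[OF p, symmetric]) (simp add: qp)
    also have "\<dots> = ennreal (\<Prod>i\<in>Basis. (u - l) \<bullet> i)"
      using le by (simp add: inner_diff_left prod_ennreal)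
    finally show "emeasure (distr (\<Pi>\<^sub>M b\<in>B. lborel) borel S) (box l u)
        = ennreal (\<Prod>i\<in>Basis. (u - l) \<bullet> i)" .
  qed simp
  have "(\<Sum>b\<in>B. c b *\<^sub>R b) = T (S c)" for c
    unfolding sum.reindex_bij_betw[OF p, of "\<lambda>b. c b *\<^sub>R b", symmetric]
    by (simp add: T_def S_def inner_sum_left_Basis)
  then have "distr (\<Pi>\<^sub>M b\<in>B. lborel) borel (\<lambda>c. \<Sum>b\<in>B. c b *\<^sub>R b) = distr lborel borel T"
    using Sm Tm by (subst eq) (simp add: distr_distr comp_def)
  then show ?thesis
    by (simp add: distr_orthogonal_lborel[OF T])
qed

section \<open>Measurability and support of \<open>subspace_lborel\<close>\<close>

lemma sets_subspace_lborel [simp, measurable_cong]: "sets (subspace_lborel V) = sets borel"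
  by (simp add: subspace_lborel_def Let_def)

lemma space_subspace_lborel [simp]: "space (subspace_lborel V) = UNIV"
  by (simp add: subspace_lborel_def Let_def)

lemma measurable_subspace_lborel [simp]: "measurable (subspace_lborel V) N = measurable borel N"
  by (intro measurable_cong_sets) auto

lemma measurable_lincomb [measurable]:
  "(\<lambda>c. \<Sum>b\<in>B. c b *\<^sub>R b) \<in> borel_measurable (\<Pi>\<^sub>M b\<in>B. (lborel :: real measure))"
  for B :: "'a::euclidean_space set"
  by (intro borel_measurable_sum borel_measurable_scaleR)
     (auto intro!: measurable_component_singleton[THEN measurable_compose])

lemma subspace_lborel_obtain_basis:
  assumes "subspace V"
  obtains B where "orthonormal_basis_of V B"
    and "subspace_lborel V = distr (\<Pi>\<^sub>M b\<in>B. lborel) borel (\<lambda>c. \<Sum>b\<in>B. c b *\<^sub>R b)"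
  using someI_ex[OF orthonormal_basis_of_exists[OF assms]]
  by (auto simp: subspace_lborel_def Let_def)

text \<open>The measure is defined on the Borel sets of the whole space, but it is pushed forward by
  linear combinations of a basis of \<open>V\<close>, which stay in \<open>V\<close>. This licenses
  assuming \<open>u \<bullet> z = 0\<close> under the integrals over hyperplanes.\<close>

lemma AE_subspace_lborel:
  fixes V :: "'a::euclidean_space set"
  assumes "subspace V"
  shows "AE z in subspace_lborel V. z \<in> V"
proof -
  obtain B where B: "orthonormal_basis_of V B"
    and eq: "subspace_lborel V = distr (\<Pi>\<^sub>M b\<in>B. lborel) borel (\<lambda>c. \<Sum>b\<in>B. c b *\<^sub>R b)"
    using subspace_lborel_obtain_basis[OF assms] .
  have "V \<in> sets borel"
    using assms by (simp add: closed_subspace borel_closed)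
  moreover have "(\<Sum>b\<in>B. c b *\<^sub>R b) \<in> V" for c
    using B by (auto simp: orthonormal_basis_of_def intro: span_sum span_scale span_base)
  ultimately show ?thesis
    unfolding eq by (subst AE_distr_iff) auto
qed

lemma orthonormal_basis_insert:
  assumes B: "orthonormal_basis_of {y. u \<bullet> y = 0} B" and u: "norm u = 1"
  shows "u \<notin> B" "orthonormal_basis_of UNIV (insert u B)"
proof -
  have perp: "u \<bullet> b = 0" if "b \<in> B" for b
    using B that span_base[OF that] unfolding orthonormal_basis_of_def by auto
  have uu: "u \<bullet> u = 1" using u by (simp add: dot_square_norm)
  show "u \<notin> B" using perp uu by force
  have "y \<in> span (insert u B)" for y
  proof -
    have "y - (u \<bullet> y) *\<^sub>R u \<in> span B"
      using B uu by (auto simp: orthonormal_basis_of_def inner_simps)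
    then show ?thesis by (auto simp: span_insert)
  qed
  then show "orthonormal_basis_of UNIV (insert u B)"
    using B u perp
    by (auto simp: orthonormal_basis_of_def pairwise_insert orthogonal_def inner_commute)
qed

section \<open>Splitting off a unit vector\<close>

text \<open>Tonelli in the coordinates of an orthonormal basis consisting of \<open>u\<close> and a
  basis of the hyperplane, with the coordinate along \<open>u\<close> integrated first.\<close>

lemma nn_integral_lborel_split:
  fixes u :: "real^'n::{finite,wellorder}"
  assumes u: "norm u = 1" and [measurable]: "F \<in> borel_measurable borel"
  shows "(\<integral>\<^sup>+ y. F y \<partial>lborel) =
    (\<integral>\<^sup>+ z. (\<integral>\<^sup>+ s. F (s *\<^sub>R u + z) \<partial>lborel) \<partial>subspace_lborel {y. u \<bullet> y = 0})"
proof -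
  obtain B where B: "orthonormal_basis_of {y. u \<bullet> y = 0} B"
    and eq: "subspace_lborel {y. u \<bullet> y = 0} = distr (\<Pi>\<^sub>M b\<in>B. lborel) borel (\<lambda>c. \<Sum>b\<in>B. c b *\<^sub>R b)"
    using subspace_lborel_obtain_basis[OF subspace_hyperplane] .
  note ins = orthonormal_basis_insert[OF B u]
  have fin: "finite B" using B by (simp add: orthonormal_basis_of_def)
  interpret product_sigma_finite "\<lambda>b :: real^'n::_. lborel :: real measure" ..
  have *: "(\<Sum>b\<in>B. (if b = u then s else c b) *\<^sub>R b) = (\<Sum>b\<in>B. c b *\<^sub>R b)" for c s
    using ins(1) by (intro sum.cong) auto
  have "(\<integral>\<^sup>+ y. F y \<partial>lborel) = (\<integral>\<^sup>+ c. F (\<Sum>b\<in>insert u B. c b *\<^sub>R b) \<partial>(\<Pi>\<^sub>M b\<in>insert u B. lborel))"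
    by (subst lborel_eq_orthonormal_basis[OF ins(2)], subst nn_integral_distr) auto
  also have "\<dots> = (\<integral>\<^sup>+ c. (\<integral>\<^sup>+ s. F (s *\<^sub>R u + (\<Sum>b\<in>B. c b *\<^sub>R b)) \<partial>lborel) \<partial>(\<Pi>\<^sub>M b\<in>B. lborel))"
    using ins(1) fin by (subst product_nn_integral_insert) (auto simp: * fun_upd_def)
  also have "\<dots> = (\<integral>\<^sup>+ z. (\<integral>\<^sup>+ s. F (s *\<^sub>R u + z) \<partial>lborel) \<partial>subspace_lborel {y. u \<bullet> y = 0})"
    unfolding eq by (subst nn_integral_distr) auto
  finally show ?thesis .
qed

text \<open>The slab \<open>0 \<le> u \<bullet> y \<le> 1\<close> has thickness one, so integrating
  over it a function of the orthogonal projection gives the hyperplane integral. The right-hand side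
  mentions no basis, so that rotations and dilations of the hyperplane measure reduce to those of
  \<open>lborel\<close>.\<close>

lemma nn_integral_subspace_lborel:
  fixes u :: "real^'n::{finite,wellorder}"
  assumes u: "norm u = 1" and [measurable]: "F \<in> borel_measurable borel"
  shows "(\<integral>\<^sup>+ z. F z \<partial>subspace_lborel {y. u \<bullet> y = 0}) =
    (\<integral>\<^sup>+ y. indicator {0..1} (u \<bullet> y) * F (y - (u \<bullet> y) *\<^sub>R u) \<partial>lborel)"
proof -
  have uu: "u \<bullet> u = 1" using u by (simp add: dot_square_norm)
  have "(\<integral>\<^sup>+ y. indicator {0..1} (u \<bullet> y) * F (y - (u \<bullet> y) *\<^sub>R u) \<partial>lborel) =
    (\<integral>\<^sup>+ z. (\<integral>\<^sup>+ s. indicator {0..1::real} s * F z \<partial>lborel) \<partial>subspace_lborel {y. u \<bullet> y = 0})"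
  proof (subst nn_integral_lborel_split[OF u], measurable, rule nn_integral_cong_AE)
    show "AE z in subspace_lborel {y. u \<bullet> y = 0}.
       (\<integral>\<^sup>+ s. indicator {0..1} (u \<bullet> (s *\<^sub>R u + z)) *
         F (s *\<^sub>R u + z - (u \<bullet> (s *\<^sub>R u + z)) *\<^sub>R u) \<partial>lborel) =
       (\<integral>\<^sup>+ s. indicator {0..1::real} s * F z \<partial>lborel)"
      using AE_subspace_lborel[OF subspace_hyperplane[of u]]
      by eventually_elim (simp add: inner_simps uu)
  qed
  also have "\<dots> = (\<integral>\<^sup>+ z. F z \<partial>subspace_lborel {y. u \<bullet> y = 0})"
    by (intro nn_integral_cong) (simp add: nn_integral_multc)
  finally show ?thesis ..
qed

text \<open>The part of the unit slab lying over the ball of radius \<open>r\<close> is contained in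
  the ball of radius \<open>r + 1\<close> of the full space.\<close>

lemma emeasure_subspace_lborel_cball:
  fixes u :: "real^'n::{finite,wellorder}"
  assumes u: "norm u = 1"
  shows "emeasure (subspace_lborel {y. u \<bullet> y = 0}) (cball 0 r) < \<infinity>"
proof -
  have "emeasure (subspace_lborel {y. u \<bullet> y = 0}) (cball 0 r) =
      (\<integral>\<^sup>+ z. indicator (cball 0 r) z \<partial>subspace_lborel {y. u \<bullet> y = 0})"
    by (rule nn_integral_indicator[symmetric]) simp
  also have "\<dots> = (\<integral>\<^sup>+ y. indicator {0..1} (u \<bullet> y) * indicator (cball 0 r) (y - (u \<bullet> y) *\<^sub>R u) \<partial>lborel)"
    by (rule nn_integral_subspace_lborel[OF u], intro borel_measurable_indicator) simp
  also have "\<dots> \<le> (\<integral>\<^sup>+ y. indicator (cball (0::real^'n::_) (r + 1)) y \<partial>lborel)"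
  proof (rule nn_integral_mono)
    fix y
    have "norm y \<le> r + 1" if "u \<bullet> y \<in> {0..1}" "norm (y - (u \<bullet> y) *\<^sub>R u) \<le> r"
    proof -
      have "norm y \<le> norm (y - (u \<bullet> y) *\<^sub>R u) + norm ((u \<bullet> y) *\<^sub>R u)"
        using norm_triangle_ineq[of "y - (u \<bullet> y) *\<^sub>R u" "(u \<bullet> y) *\<^sub>R u"] by simp
      with that u show ?thesis by simp
    qed
    then show "indicator {0..1} (u \<bullet> y) * indicator (cball 0 r) (y - (u \<bullet> y) *\<^sub>R u)
        \<le> (indicator (cball 0 (r + 1)) y :: ennreal)"
      by (auto split: split_indicator)
  qed
  also have "\<dots> = emeasure lborel (cball (0::real^'n::_) (r + 1))"
    by simp
  also have "\<dots> < \<infinity>"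
    by (rule emeasure_bounded_finite) simp
  finally show ?thesis .
qed

lemma sigma_finite_subspace_lborel:
  fixes u :: "real^'n::{finite,wellorder}"
  assumes u: "norm u = 1"
  shows "sigma_finite_measure (subspace_lborel {y. u \<bullet> y = 0})"
proof (rule sigma_finite_measure.intro, intro exI conjI ballI)
  let ?A = "range (\<lambda>k::nat. cball (0::real^'n::_) (real k))"
  show "countable ?A" by auto
  show "?A \<subseteq> sets (subspace_lborel {y. u \<bullet> y = 0})" by auto
  show "\<Union>?A = space (subspace_lborel {y. u \<bullet> y = 0})"
    using real_arch_simple by (auto simp: mem_cball_0)
  show "emeasure (subspace_lborel {y. u \<bullet> y = 0}) C \<noteq> \<infinity>" if "C \<in> ?A" for C
    using that emeasure_subspace_lborel_cball[OF u] by (auto simp: less_top)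
qed

text \<open>\<open>R\<close> maps the slab of \<open>u\<close> onto the slab of \<open>R u\<close>,
  commutes with the two projections and preserves \<open>lborel\<close>.\<close>

lemma distr_orthogonal_subspace_lborel:
  fixes R :: "real^'n::{finite,wellorder} \<Rightarrow> real^'n::_"
  assumes u: "norm u = 1" and R: "orthogonal_transformation R"
  shows "subspace_lborel {y. R u \<bullet> y = 0} = distr (subspace_lborel {y. u \<bullet> y = 0}) borel R"
proof (rule measure_eqI)
  have lin: "linear R" using R by (rule orthogonal_transformation_linear)
  have [measurable]: "R \<in> borel_measurable borel"
    by (intro borel_measurable_continuous_onI linear_continuous_on linear_linear[THEN iffD2] lin)
  have Ru: "norm (R u) = 1" using R u by (simp add: orthogonal_transformation_norm)
  have ip: "R u \<bullet> R y = u \<bullet> y" for y using R by (simp add: orthogonal_transformation_def)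
  fix A assume "A \<in> sets (subspace_lborel {y. R u \<bullet> y = 0})"
  then have [measurable]: "A \<in> sets borel" by simp
  have "emeasure (subspace_lborel {y. R u \<bullet> y = 0}) A =
      (\<integral>\<^sup>+ z. indicator A z \<partial>subspace_lborel {y. R u \<bullet> y = 0})" by simp
  also have "\<dots> = (\<integral>\<^sup>+ y. indicator {0..1} (R u \<bullet> y) * indicator A (y - (R u \<bullet> y) *\<^sub>R R u) \<partial>lborel)"
    by (subst nn_integral_subspace_lborel[OF Ru]) auto
  also have "\<dots> = (\<integral>\<^sup>+ y. indicator {0..1} (u \<bullet> y) * indicator A (R (y - (u \<bullet> y) *\<^sub>R u)) \<partial>lborel)"
    by (subst distr_orthogonal_lborel[OF R, symmetric], subst nn_integral_distr)
       (auto simp: ip linear_diff[OF lin] linear_scale[OF lin])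
  also have "\<dots> = (\<integral>\<^sup>+ z. indicator A (R z) \<partial>subspace_lborel {y. u \<bullet> y = 0})"
    by (subst nn_integral_subspace_lborel[OF u]) auto
  also have "\<dots> = (\<integral>\<^sup>+ z. indicator A z \<partial>distr (subspace_lborel {y. u \<bullet> y = 0}) borel R)"
    by (subst nn_integral_distr) auto
  also have "\<dots> = emeasure (distr (subspace_lborel {y. u \<bullet> y = 0}) borel R) A" by simp
  finally show "emeasure (subspace_lborel {y. R u \<bullet> y = 0}) A =
    emeasure (distr (subspace_lborel {y. u \<bullet> y = 0}) borel R) A" .
qed simp

text \<open>Dilating the full space contributes \<open>r ^ CARD('n)\<close>, while the unit slab
  becomes a slab of thickness \<open>inverse r\<close>; the product is the power belonging to
  dimension \<open>CARD('n) - 1\<close>.\<close>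

lemma subspace_lborel_scale:
  fixes u :: "real^'n::{finite,wellorder}"
  assumes u: "norm u = 1" and r: "r > 0"
  shows "subspace_lborel {y. u \<bullet> y = 0} =
    density (distr (subspace_lborel {y. u \<bullet> y = 0}) borel (\<lambda>z. r *\<^sub>R z)) (\<lambda>_. r ^ (CARD('n) - 1))"
proof (rule measure_eqI)
  let ?L = "subspace_lborel {y. u \<bullet> y = 0}"
  have uu: "u \<bullet> u = 1" using u by (simp add: dot_square_norm)
  fix A assume "A \<in> sets ?L"
  then have [measurable]: "A \<in> sets borel" by simp
  have "emeasure ?L A = (\<integral>\<^sup>+ z. indicator A z \<partial>?L)" by simp
  also have "\<dots> = (\<integral>\<^sup>+ y. indicator {0..1} (u \<bullet> y) * indicator A (y - (u \<bullet> y) *\<^sub>R u) \<partial>lborel)"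
    by (subst nn_integral_subspace_lborel[OF u]) auto
  also have "\<dots> = r ^ CARD('n) * (\<integral>\<^sup>+ y. indicator {0..1} (u \<bullet> (r *\<^sub>R y)) *
      indicator A (r *\<^sub>R y - (u \<bullet> (r *\<^sub>R y)) *\<^sub>R u) \<partial>lborel)"
    using r by (subst lborel_affine[of r 0])
      (auto simp: nn_integral_density nn_integral_distr nn_integral_cmult)
  also have "(\<integral>\<^sup>+ y. indicator {0..1} (u \<bullet> (r *\<^sub>R y)) *
      indicator A (r *\<^sub>R y - (u \<bullet> (r *\<^sub>R y)) *\<^sub>R u) \<partial>lborel) =
      (\<integral>\<^sup>+ z. (\<integral>\<^sup>+ s. indicator {0..inverse r} s * indicator A (r *\<^sub>R z) \<partial>lborel) \<partial>?L)"
  proof (subst nn_integral_lborel_split[OF u], measurable, rule nn_integral_cong_AE)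
    have ind: "indicator {0..1} (r * s) = (indicator {0..inverse r} s :: ennreal)" for s
      using r by (auto simp: field_simps zero_le_mult_iff split: split_indicator)
    show "AE z in ?L.
       (\<integral>\<^sup>+ s. indicator {0..1} (u \<bullet> (r *\<^sub>R (s *\<^sub>R u + z))) *
         indicator A (r *\<^sub>R (s *\<^sub>R u + z) - (u \<bullet> (r *\<^sub>R (s *\<^sub>R u + z))) *\<^sub>R u) \<partial>lborel) =
       (\<integral>\<^sup>+ s. indicator {0..inverse r} s * indicator A (r *\<^sub>R z) \<partial>lborel)"
      using AE_subspace_lborel[OF subspace_hyperplane[of u]]
      by eventually_elim (simp add: inner_simps uu scaleR_add_right ind)
  qed
  also have "\<dots> = (\<integral>\<^sup>+ z. ennreal (inverse r) * indicator A (r *\<^sub>R z) \<partial>?L)"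
    using r by (intro nn_integral_cong) (simp add: nn_integral_multc)
  also have "\<dots> = inverse r * (\<integral>\<^sup>+ z. indicator A (r *\<^sub>R z) \<partial>?L)"
    by (subst nn_integral_cmult) auto
  also have "(r ^ CARD('n)) * (inverse r * (\<integral>\<^sup>+ z. indicator A (r *\<^sub>R z) \<partial>?L)) =
      (r ^ (CARD('n) - 1)) * (\<integral>\<^sup>+ z. indicator A (r *\<^sub>R z) \<partial>?L)"
  proof -
    have "r ^ CARD('n) * inverse r = r ^ (CARD('n) - 1)"
      using r by (simp add: power_eq_if)
    then show ?thesis
      using r by (simp add: mult.assoc[symmetric] ennreal_mult'[symmetric])
  qed
  also have "(\<integral>\<^sup>+ z. indicator A (r *\<^sub>R z) \<partial>?L) = emeasure (distr ?L borel (\<lambda>z. r *\<^sub>R z)) A"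
    by (subst nn_integral_indicator[symmetric], simp, subst nn_integral_distr) auto
  also have "(r ^ (CARD('n) - 1)) * emeasure (distr ?L borel (\<lambda>z. r *\<^sub>R z)) A =
      emeasure (density (distr ?L borel (\<lambda>z. r *\<^sub>R z)) (\<lambda>_. r ^ (CARD('n) - 1))) A"
    using r by (simp add: emeasure_density nn_integral_cmult_indicator)
  finally show "emeasure ?L A = \<dots>" .
qed simp

section \<open>Integration over spheres\<close>

text \<open>The extension that is homogeneous of degree zero, through which integrals over spheres
  become integrals over balls. The value at the origin keeps both the invariance under positive
  scaling and the bounds valid there.\<close>

definition radial_ext :: "('a::euclidean_space \<Rightarrow> real) \<Rightarrow> 'a \<Rightarrow> real" where
  "radial_ext h z = (if z = 0 then 0 else h (sgn z))"

lemma sphere_bounded_obtain: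
  fixes h :: "'a::euclidean_space \<Rightarrow> real"
  assumes "continuous_on (sphere 0 1) h"
  obtains C where "C > 0" "\<And>\<xi>. norm \<xi> = 1 \<Longrightarrow> \<bar>h \<xi>\<bar> \<le> C"
proof -
  have "bounded (h ` sphere 0 1)"
    by (intro compact_imp_bounded compact_continuous_image assms compact_sphere)
  then obtain C where "C > 0" "\<forall>v\<in>h ` sphere 0 1. norm v \<le> C"
    by (auto simp: bounded_pos)
  then show ?thesis by (intro that[of C]) auto
qed

lemma sphere_bounded_radial_ext:
  assumes "\<And>\<xi>. norm \<xi> = 1 \<Longrightarrow> \<bar>h \<xi>\<bar> \<le> C" "C > 0"
  shows "\<bar>radial_ext h z\<bar> \<le> C"
  using assms(1)[of "sgn z"] assms(2) by (auto simp: radial_ext_def norm_sgn)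

lemma radial_ext_scale: "r > 0 \<Longrightarrow> radial_ext h (r *\<^sub>R z) = radial_ext h z"
  by (auto simp: radial_ext_def sgn_scaleR)

lemma continuous_on_radial_ext:
  fixes h :: "'a::euclidean_space \<Rightarrow> real"
  assumes h: "continuous_on (sphere 0 1) h"
  shows "continuous_on (- {0}) (radial_ext h)"
proof -
  have "continuous_on (- {0}) (\<lambda>z. h (sgn z))"
    by (rule continuous_on_compose2[OF h])
       (auto intro!: continuous_intros simp: norm_sgn split: if_splits)
  then show ?thesis
    by (rule continuous_on_eq) (auto simp: radial_ext_def)
qed

lemma borel_measurable_radial_ext:
  fixes h :: "'a::euclidean_space \<Rightarrow> real"
  assumes h: "h \<in> borel_measurable (restrict_space borel (sphere 0 1))"
  shows "radial_ext h \<in> borel_measurable borel"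
proof -
  have "(\<lambda>z::'a. z /\<^sub>R norm z) \<in> borel_measurable borel" by measurable
  then have "sgn \<in> borel_measurable (borel :: 'a measure)" by (simp add: sgn_div_norm[abs_def])
  then have "sgn \<in> measurable (restrict_space borel (- {0})) (restrict_space borel (sphere (0::'a) 1))"
    by (intro measurable_restrict_space3) (auto simp: norm_sgn)
  from measurable_compose[OF this h]
  have "(\<lambda>z. indicator (- {0}) z *\<^sub>R h (sgn z)) \<in> borel_measurable borel"
    by (subst (asm) borel_measurable_restrict_space_iff) auto
  also have "(\<lambda>z. indicator (- {0}) z *\<^sub>R h (sgn z)) = radial_ext h"
    by (auto simp: radial_ext_def)
  finally show ?thesis .
qed

lemma borel_measurable_cball_radial_ext:
  fixes h :: "'a::euclidean_space \<Rightarrow> real"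
  assumes h: "h \<in> borel_measurable (restrict_space borel (sphere 0 1))"
  shows "(\<lambda>z. indicator (cball 0 r) z * radial_ext h z) \<in> borel_measurable borel"
  by (intro borel_measurable_times borel_measurable_indicator borel_measurable_radial_ext h) simp

section \<open>The cone formula for integrals\<close>

text \<open>The integer scale factor is rewritten as a constant density, the form to which the
  transfer rules for Bochner integrals apply.\<close>

lemma sphere_measure_eq_density:
  fixes V :: "'a::euclidean_space set"
  assumes V: "subspace V"
  shows "sphere_measure V =
     distr (density (restrict_space (subspace_lborel V) (V \<inter> cball 0 1 - {0})) (\<lambda>_. ennreal (real (dim V))))
       (restrict_space borel (V \<inter> sphere 0 1)) (\<lambda>y. y /\<^sub>R norm y)"
proof -
  have "scale_measure (of_nat (dim V)) M = density M (\<lambda>_. ennreal (real (dim V)))" for M :: "'a measure"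
    by (rule measure_eqI) (auto simp: emeasure_density_const ennreal_of_nat_eq_real_of_nat)
  then show ?thesis by (simp add: sphere_measure_def)
qed

lemma measurable_cone_normalize:
  fixes V :: "'a::euclidean_space set"
  assumes V: "subspace V"
  shows "(\<lambda>y. y /\<^sub>R norm y) \<in> measurable (restrict_space borel (V \<inter> cball 0 1 - {0}))
       (restrict_space borel (V \<inter> sphere 0 1))"
proof (rule measurable_restrict_space2)
  show "(\<lambda>y. y /\<^sub>R norm y) \<in> space (restrict_space borel (V \<inter> cball 0 1 - {0})) \<rightarrow> V \<inter> sphere 0 1"
    using V by (auto simp: space_restrict_space subspace_scale)
  show "(\<lambda>y. y /\<^sub>R norm y) \<in> borel_measurable (restrict_space borel (V \<inter> cball 0 1 - {0}))"
    by (intro measurable_restrict_space1) measurable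
qed

lemma sets_cone [measurable]:
  fixes V :: "'a::euclidean_space set"
  assumes V: "subspace V"
  shows "V \<inter> cball 0 1 - {0} \<in> sets borel"
  using closed_subspace[OF V] by (intro sets.Diff sets.Int) auto

lemma borel_measurable_sphere:
  fixes h :: "'a::euclidean_space \<Rightarrow> real"
  assumes h: "h \<in> borel_measurable (restrict_space borel (sphere 0 1))"
  shows "h \<in> borel_measurable (sphere_measure V)"
  using measurable_restrict_mono[OF h, of "V \<inter> sphere 0 1"] by (simp add: sphere_measure_def)

lemma space_sphere_measure [simp]: "space (sphere_measure V) = V \<inter> sphere 0 1"
  by (simp add: sphere_measure_def space_restrict_space)

lemma integral_sphere_measure:
  fixes V :: "'a::euclidean_space set"
  assumes V: "subspace V" and h: "h \<in> borel_measurable (restrict_space borel (sphere 0 1))"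
  shows "(\<integral>\<xi>. h \<xi> \<partial>sphere_measure V) =
     dim V * (\<integral>z. indicator (cball 0 1) z * radial_ext h z \<partial>subspace_lborel V)"
proof -
  let ?C = "V \<inter> cball 0 1 - {0}" and ?L = "subspace_lborel V"
  note [measurable] = borel_measurable_radial_ext[OF h] sets_cone[OF V]
  have hm: "h \<in> borel_measurable (restrict_space borel (V \<inter> sphere 0 1))"
    by (rule measurable_restrict_mono[OF h]) auto
  have sets: "sets (restrict_space ?L ?C) = sets (restrict_space borel ?C)"
    by (rule sets_restrict_space_cong) simp
  have nm: "(\<lambda>y. y /\<^sub>R norm y) \<in> measurable (restrict_space ?L ?C) (restrict_space borel (V \<inter> sphere 0 1))"
    using measurable_cone_normalize[OF V] by (simp add: measurable_cong_sets[OF sets refl])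
  have hn: "(\<lambda>y. h (y /\<^sub>R norm y)) \<in> borel_measurable (restrict_space ?L ?C)"
    by (rule measurable_compose[OF nm hm])
  have "(\<integral>\<xi>. h \<xi> \<partial>sphere_measure V) = (\<integral>y. real (dim V) *\<^sub>R h (y /\<^sub>R norm y) \<partial>restrict_space ?L ?C)"
    using nm hm hn
    by (simp add: sphere_measure_eq_density[OF V] integral_distr integral_density)
  also have "\<dots> = dim V * (\<integral>z. indicator ?C z * h (z /\<^sub>R norm z) \<partial>?L)"
    by (simp add: integral_restrict_space)
  \<comment> \<open>The punctured cone may be replaced by the whole ball: almost every
    \<open>z\<close> lies in \<open>V\<close>, and at the origin \<open>radial_ext h\<close> is
    \<open>0\<close>.\<close>
  also have "(\<integral>z. indicator ?C z * h (z /\<^sub>R norm z) \<partial>?L) = (\<integral>z. indicator (cball 0 1) z * radial_ext h z \<partial>?L)"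
  proof (rule integral_cong_AE)
    show "(\<lambda>z. indicator ?C z * h (z /\<^sub>R norm z)) \<in> borel_measurable ?L"
      using hn by (subst (asm) borel_measurable_restrict_space_iff) auto
    show "AE z in ?L. indicator ?C z * h (z /\<^sub>R norm z) = indicator (cball 0 1) z * radial_ext h z"
      using AE_subspace_lborel[OF V]
      by eventually_elim (auto simp: radial_ext_def sgn_div_norm split: split_indicator)
  qed (use borel_measurable_cball_radial_ext[OF h] in simp)
  finally show ?thesis .
qed

lemma finite_measure_sphere_measure:
  fixes V :: "'a::euclidean_space set"
  assumes V: "subspace V" and fin: "emeasure (subspace_lborel V) (cball 0 1) < \<infinity>"
  shows "finite_measure (sphere_measure V)"
proof (rule finite_measureI)
  let ?C = "V \<inter> cball 0 1 - {0}" and ?L = "subspace_lborel V"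
  note [measurable] = sets_cone[OF V]
  have sets: "sets (restrict_space ?L ?C) = sets (restrict_space borel ?C)"
    by (rule sets_restrict_space_cong) simp
  have nm: "(\<lambda>y. y /\<^sub>R norm y) \<in> measurable (restrict_space ?L ?C) (restrict_space borel (V \<inter> sphere 0 1))"
    using measurable_cone_normalize[OF V] by (simp add: measurable_cong_sets[OF sets refl])
  have "(\<lambda>y. y /\<^sub>R norm y) -` (V \<inter> sphere 0 1) \<inter> ?C = ?C"
    using measurable_space[OF nm] by (auto simp: space_restrict_space)
  moreover have "(\<lambda>y. y /\<^sub>R norm y) \<in> measurable (scale_measure (of_nat (dim V)) (restrict_space ?L ?C))
      (restrict_space borel (V \<inter> sphere 0 1))"
    using nm by (simp add: measurable_cong_sets[OF sets_scale_measure refl])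
  moreover have "V \<inter> sphere 0 1 \<in> sets (restrict_space borel (V \<inter> sphere 0 1))"
    using sets.top[of "restrict_space borel (V \<inter> sphere 0 1)"] by (simp add: space_restrict_space)
  ultimately have "emeasure (sphere_measure V) (space (sphere_measure V)) = dim V * emeasure (restrict_space ?L ?C) ?C"
    by (simp add: sphere_measure_def emeasure_distr space_scale_measure space_restrict_space)
  also have "\<dots> = dim V * emeasure ?L ?C"
    by (subst emeasure_restrict_space) auto
  also have "\<dots> < \<infinity>"
  proof -
    have "emeasure ?L ?C \<le> emeasure ?L (cball 0 1)" by (rule emeasure_mono) auto
    with fin have "emeasure ?L ?C < \<infinity>" by (rule le_less_trans[rotated])
    then show ?thesis by (simp add: ennreal_mult_less_top of_nat_less_top)
  qed
  finally show "emeasure (sphere_measure V) (space (sphere_measure V)) \<noteq> \<infinity>" by simp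
qed

lemma finite_sphere_measure_UNIV:
  "finite_measure (sphere_measure (UNIV :: (real^'n::{finite,wellorder}) set))"
  by (intro finite_measure_sphere_measure)
     (auto simp: subspace_lborel_UNIV intro: emeasure_bounded_finite[unfolded infinity_ennreal_def])

lemma finite_sphere_measure_hyperplane:
  fixes u :: "real^'n::{finite,wellorder}"
  assumes "norm u = 1"
  shows "finite_measure (sphere_measure {y. u \<bullet> y = 0})"
  by (intro finite_measure_sphere_measure emeasure_subspace_lborel_cball assms subspace_hyperplane)

text \<open>The cone over the great sphere orthogonal to \<open>x\<close> lies in a hyperplane, a
  Lebesgue null set. Hence the jump of \<open>sgn (x \<bullet> \<xi>)\<close> is invisible to
  derivatives and limits taken almost everywhere.\<close>

lemma AE_sphere_measure_inner_nonzero: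
  fixes x :: "real^'n::{finite,wellorder}"
  assumes x: "x \<noteq> 0"
  shows "AE \<xi> in sphere_measure UNIV. x \<bullet> \<xi> \<noteq> 0"
proof -
  have "{y. x \<bullet> y = 0} \<in> null_sets lborel"
    using negligible_hyperplane[of x 0] x
    by (auto simp: negligible_iff_null_sets null_sets_completion_iff)
  then have "AE y in lborel. x \<bullet> y \<noteq> 0"
    by (auto dest: AE_not_in)
  then have ae: "AE y in restrict_space lborel (cball 0 1 - {0}). x \<bullet> (y /\<^sub>R norm y) \<noteq> 0"
    by (auto simp: AE_restrict_space_iff elim: eventually_mono)
  have nm: "(\<lambda>y. y /\<^sub>R norm y) \<in> measurable (restrict_space lborel (cball 0 1 - {0::real^'n::_}))
       (restrict_space borel (sphere 0 1))"
    using measurable_cone_normalize[of "UNIV :: (real^'n::_) set"]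
    by (simp add: measurable_cong_sets[OF sets_restrict_space_cong[OF sets_lborel] refl])
  have "{\<xi> \<in> space (restrict_space borel (sphere 0 1)). x \<bullet> \<xi> \<noteq> 0} \<in> sets (restrict_space borel (sphere 0 1))"
    by (subst sets_restrict_space_iff) (auto simp: space_restrict_space)
  then show ?thesis
    unfolding sphere_measure_eq_density[OF subspace_UNIV] subspace_lborel_UNIV Int_UNIV_left
    using nm ae by (simp add: AE_distr_iff AE_density)
qed

lemma integral_subspace_lborel_scale:
  fixes u :: "real^'n::{finite,wellorder}" and F :: "real^'n::_ \<Rightarrow> real"
  assumes u: "norm u = 1" and r: "r > 0" and [measurable]: "F \<in> borel_measurable borel"
  shows "(\<integral>z. F z \<partial>subspace_lborel {y. u \<bullet> y = 0}) =
    r ^ (CARD('n) - 1) * (\<integral>z. F (r *\<^sub>R z) \<partial>subspace_lborel {y. u \<bullet> y = 0})"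
  using r by (subst subspace_lborel_scale[OF u r], subst integral_density)
    (auto simp: integral_distr)

text \<open>Layer-cake: on the unit ball \<open>1 - \<parallel>z\<parallel>\<close> is the length of \<open>{\<parallel>z\<parallel>..1}\<close>, and the integral over the
  ball of radius \<open>r\<close> scales as \<open>r\<^sup>d\<close>.\<close>

lemma integral_norm_radial_ext:
  fixes u :: "real^'n::{finite,wellorder}"
  assumes u: "norm u = 1" and h: "continuous_on (sphere 0 1) h"
  shows "CARD('n) * (\<integral>z. indicator (cball 0 1) z * (norm z * radial_ext h z) \<partial>subspace_lborel {y. u \<bullet> y = 0}) =
    (CARD('n) - 1) * (\<integral>z. indicator (cball 0 1) z * radial_ext h z \<partial>subspace_lborel {y. u \<bullet> y = 0})"
proof -
  let ?L = "subspace_lborel {y. u \<bullet> y = 0}"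
  define d where "d = CARD('n) - 1"
  have d: "CARD('n) = Suc d" unfolding d_def by simp
  note hm = borel_measurable_continuous_on_restrict[OF h]
  note [measurable] = borel_measurable_radial_ext[OF hm]
  obtain C where C: "C > 0" "\<And>\<xi>. norm \<xi> = 1 \<Longrightarrow> \<bar>h \<xi>\<bar> \<le> C"
    using sphere_bounded_obtain[OF h] by blast
  have bnd: "\<bar>radial_ext h z\<bar> \<le> C" for z
    by (rule sphere_bounded_radial_ext[OF C(2) C(1)])
  note cball_meas = borel_measurable_cball_radial_ext[OF hm]
  interpret L: sigma_finite_measure ?L by (rule sigma_finite_subspace_lborel[OF u])
  interpret P: pair_sigma_finite "lborel :: real measure" ?L ..
  have fin: "emeasure ?L (cball 0 1) < \<infinity>" by (rule emeasure_subspace_lborel_cball[OF u])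
  define I where "I = (\<integral>z. indicator (cball 0 1) z * radial_ext h z \<partial>?L)"
  have I: "(\<integral>z. indicator (cball 0 r) z * radial_ext h z \<partial>?L) = r ^ d * I" if r: "r > 0" for r
  proof -
    have "indicator (cball 0 r) (r *\<^sub>R z) = (indicator (cball 0 1) z :: real)" for z :: "real^'n::_"
      using r by (auto split: split_indicator)
    then show ?thesis
      using r by (subst integral_subspace_lborel_scale[OF u r]) (auto simp: I_def d_def radial_ext_scale borel_measurable_cball_radial_ext[OF hm])
  qed
  \<comment> \<open>Integrating \<open>F\<close> over \<open>r\<close> gives the weight
    \<open>1 - norm z\<close>; integrating it over \<open>z\<close> gives the integral over the ball
    of radius \<open>r\<close>. Fubini equates the two.\<close>
  define F where "F r z = indicator (cball 0 1) z * indicator {norm z..1} r * radial_ext h z" for r :: real and z :: "real^'n::_"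
  have meas: "(\<lambda>x. F (fst x) (snd x)) \<in> borel_measurable (lborel \<Otimes>\<^sub>M ?L)"
  proof -
    have "(\<lambda>x. F (fst x) (snd x)) = (\<lambda>x. if norm (snd x) \<le> 1 \<and> norm (snd x) \<le> fst x \<and> fst x \<le> 1 then radial_ext h (snd x) else 0)"
      by (auto simp: F_def fun_eq_iff split: split_indicator)
    then show ?thesis by simp
  qed
  have int: "integrable (lborel \<Otimes>\<^sub>M ?L) (case_prod F)"
  proof (rule integrableI_bounded_set[where A="{0..1} \<times> cball 0 1" and B=C])
    show "case_prod F \<in> borel_measurable (lborel \<Otimes>\<^sub>M ?L)" using meas by (simp add: case_prod_unfold)
    show "emeasure (lborel \<Otimes>\<^sub>M ?L) ({0..1::real} \<times> cball 0 1) < \<infinity>"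
      using fin by (subst L.emeasure_pair_measure_Times) auto
    show "AE x in lborel \<Otimes>\<^sub>M ?L. x \<in> {0..1} \<times> cball 0 1 \<longrightarrow> norm (case_prod F x) \<le> C"
      using bnd C(1) by (intro AE_I2) (auto simp: F_def abs_mult split: split_indicator)
    show "AE x in lborel \<Otimes>\<^sub>M ?L. x \<notin> {0..1} \<times> cball 0 1 \<longrightarrow> case_prod F x = 0"
      by (intro AE_I2) (auto simp: F_def indicator_def intro: order_trans[OF norm_ge_zero])
  qed simp
  have "(\<integral>z. (\<integral>r. F r z \<partial>lborel) \<partial>?L) = (\<integral>r. (\<integral>z. F r z \<partial>?L) \<partial>lborel)"
    by (rule P.Fubini_integral[OF int])
  also have "(\<integral>z. (\<integral>r. F r z \<partial>lborel) \<partial>?L) = (\<integral>z. indicator (cball 0 1) z * (1 - norm z) * radial_ext h z \<partial>?L)"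
    by (intro Bochner_Integration.integral_cong) (auto simp: F_def split: split_indicator)
  also have "\<dots> = (\<integral>z. indicator (cball 0 1) z * radial_ext h z - indicator (cball 0 1) z * (norm z * radial_ext h z) \<partial>?L)"
    by (intro Bochner_Integration.integral_cong) (auto simp: algebra_simps)
  also have "\<dots> = I - (\<integral>z. indicator (cball 0 1) z * (norm z * radial_ext h z) \<partial>?L)"
    unfolding I_def
  proof (rule Bochner_Integration.integral_diff)
    show "integrable ?L (\<lambda>z. indicator (cball 0 1) z * radial_ext h z)"
      using fin bnd by (intro integrableI_bounded_set[where A="cball 0 1" and B=C])
        (auto simp: cball_meas)
    show "integrable ?L (\<lambda>z. indicator (cball 0 1) z * (norm z * radial_ext h z))"
    proof (rule integrableI_bounded_set[where A="cball 0 1" and B="1 * C"])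
      show "AE z in ?L. z \<in> cball 0 1 \<longrightarrow> norm (indicator (cball 0 1) z * (norm z * radial_ext h z)) \<le> 1 * C"
        using mult_mono[OF _ bnd, of _ 1] by (intro AE_I2 impI) (auto simp: abs_mult)
    next
      have "(\<lambda>z. norm z * (indicator (cball 0 1) z * radial_ext h z)) \<in> borel_measurable borel"
        using cball_meas by measurable
      then show "(\<lambda>z. indicator (cball 0 1) z * (norm z * radial_ext h z)) \<in> borel_measurable ?L"
        by (simp add: mult_ac)
    qed (use fin in auto)
  qed
  also have "(\<integral>r. (\<integral>z. F r z \<partial>?L) \<partial>lborel) = (\<integral>r. (r ^ d * indicator {0..1} r) * I \<partial>lborel)"
  proof (rule integral_cong_AE)
    \<comment> \<open>The scaling law \<open>I\<close> requires \<open>r > 0\<close>; the single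
      point \<open>r = 0\<close> is discarded as a null set.\<close>
    have "AE r in lborel. r \<noteq> (0::real)" by (rule AE_lborel_singleton)
    then show "AE r in lborel. (\<integral>z. F r z \<partial>?L) = (r ^ d * indicator {0..1} r) * I"
    proof eventually_elim
      fix r :: real assume "r \<noteq> 0"
      consider "r < 0" | "r > 1" | "0 < r" "r \<le> 1" using \<open>r \<noteq> 0\<close> by linarith
      then show "(\<integral>z. F r z \<partial>?L) = (r ^ d * indicator {0..1} r) * I"
      proof cases
        case 1
        then have "\<not> norm z \<le> r" for z :: "real^'n::_" using norm_ge_zero[of z] by linarith
        then have "F r z = 0" for z by (simp add: F_def indicator_def)
        with 1 show ?thesis by simp
      next
        case 2
        then have "F r z = 0" for z by (auto simp: F_def split: split_indicator)
        with 2 show ?thesis by simp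
      next
        case 3
        then have "F r z = indicator (cball 0 r) z * radial_ext h z" for z
          by (auto simp: F_def split: split_indicator)
        with 3 I show ?thesis by simp
      qed
    qed
    show "(\<lambda>r. \<integral>z. F r z \<partial>?L) \<in> borel_measurable lborel"
      by (rule L.borel_measurable_lebesgue_integral[OF borel_measurable_integrable[OF int]])
  qed simp
  also have "\<dots> = I / Suc d"
    using integral_power[of 0 1 d] by simp
  finally have "I - (\<integral>z. indicator (cball 0 1) z * (norm z * radial_ext h z) \<partial>?L) = I / Suc d" by simp
  then show ?thesis
    unfolding I_def[symmetric] d by (simp add: field_simps)
qed

section \<open>The derivative of the hemispherical transform\<close>

text \<open>Dominated convergence for the difference quotients along sequences tending to
  \<open>0\<close>. The integrand need only be differentiable at \<open>0\<close>, almost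
  everywhere, and is compared only with its value at \<open>0\<close>: this suits kernels that are
  not differentiable at every point.\<close>

lemma has_field_derivative_integral:
  fixes F :: "real \<Rightarrow> 'a \<Rightarrow> real"
  assumes d: "d > 0"
    and int: "\<And>t. \<bar>t\<bar> < d \<Longrightarrow> integrable M (F t)"
    and meas: "F' \<in> borel_measurable M"
    and w: "integrable M w"
    and bnd: "\<And>t. \<bar>t\<bar> < d \<Longrightarrow> AE x in M. \<bar>F t x - F 0 x\<bar> \<le> \<bar>t\<bar> * w x"
    and deriv: "AE x in M. ((\<lambda>t. F t x) has_field_derivative F' x) (at 0)"
  shows "((\<lambda>t. \<integral>x. F t x \<partial>M) has_field_derivative (\<integral>x. F' x \<partial>M)) (at 0)"
proof -
  have "((\<lambda>t. ((\<integral>x. F t x \<partial>M) - (\<integral>x. F 0 x \<partial>M)) / t) \<longlongrightarrow> (\<integral>x. F' x \<partial>M)) (at 0)"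
    unfolding tendsto_at_iff_sequentially
  proof (intro allI impI)
    fix X :: "nat \<Rightarrow> real" assume X: "\<forall>i. X i \<in> UNIV - {0}" "X \<longlonglongrightarrow> 0"
    then have "eventually (\<lambda>n. \<bar>X n\<bar> < d) sequentially"
      using order_tendstoD(2)[OF tendsto_rabs_zero[OF X(2)] d] by simp
    \<comment> \<open>Shifting the sequence by \<open>N\<close> puts all its terms in the range
      where integrability and domination hold.\<close>
    then obtain N where N: "\<And>n. n \<ge> N \<Longrightarrow> \<bar>X n\<bar> < d" by (auto simp: eventually_sequentially)
    have "(\<lambda>n. \<integral>x. (F (X (n + N)) x - F 0 x) / X (n + N) \<partial>M) \<longlonglongrightarrow> (\<integral>x. F' x \<partial>M)"
    proof (rule integral_dominated_convergence[where w=w])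
      show "(\<lambda>x. (F (X (n + N)) x - F 0 x) / X (n + N)) \<in> borel_measurable M" for n
        using int[OF N[of "n + N"]] int[of 0] d
        by (intro borel_measurable_divide borel_measurable_diff borel_measurable_integrable) auto
      show "AE x in M. norm ((F (X (n + N)) x - F 0 x) / X (n + N)) \<le> w x" for n
        using bnd[OF N[of "n + N", simplified]]
      proof eventually_elim
        case (elim x)
        moreover have "X (n + N) \<noteq> 0" using X(1) by auto
        ultimately show ?case by (simp add: divide_simps mult.commute)
      qed
      show "AE x in M. (\<lambda>n. (F (X (n + N)) x - F 0 x) / X (n + N)) \<longlonglongrightarrow> F' x"
        using deriv
      proof eventually_elim
        case (elim x)
        then have "((\<lambda>t. (F t x - F 0 x) / t) \<longlongrightarrow> F' x) (at 0)"
          by (simp add: DERIV_def)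
        then have "(\<lambda>n. (F (X n) x - F 0 x) / X n) \<longlonglongrightarrow> F' x"
          using X unfolding tendsto_at_iff_sequentially by (auto simp: comp_def)
        then show ?case by (rule LIMSEQ_ignore_initial_segment)
      qed
    qed (use meas w in auto)
    also have "(\<lambda>n. \<integral>x. (F (X (n + N)) x - F 0 x) / X (n + N) \<partial>M) =
        (\<lambda>n. ((\<integral>x. F (X (n + N)) x \<partial>M) - (\<integral>x. F 0 x \<partial>M)) / X (n + N))"
      using int[OF N] int[of 0] d by (intro ext) (simp add: Bochner_Integration.integral_diff)
    finally show "((\<lambda>t. ((\<integral>x. F t x \<partial>M) - (\<integral>x. F 0 x \<partial>M)) / t) \<circ> X) \<longlonglongrightarrow> (\<integral>x. F' x \<partial>M)"
      unfolding comp_def by (rule LIMSEQ_offset)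
  qed
  then show ?thesis by (simp add: DERIV_def)
qed

section \<open>Moving the jump of the sign function\<close>

text \<open>Moving the jump from \<open>0\<close> to \<open>a\<close> changes the sign function by
  \<open>- 2 * sgn a\<close> between the two points and nowhere else; the end points form a null
  set.\<close>

lemma integral_sgn_shift_diff:
  fixes \<psi> :: "real \<Rightarrow> real"
  assumes int: "integrable lborel \<psi>"
  shows "(\<integral>s. \<psi> s * sgn (s - a) \<partial>lborel) - (\<integral>s. \<psi> s * sgn s \<partial>lborel) =
    - 2 * sgn a * (\<integral>s. indicator {min 0 a..max 0 a} s * \<psi> s \<partial>lborel)"
proof -
  have [measurable]: "\<psi> \<in> borel_measurable borel" using borel_measurable_integrable[OF int] by simp
  have int': "integrable lborel (\<lambda>s. \<psi> s * sgn (s - b))" for b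
    by (rule Bochner_Integration.integrable_bound[OF int]) (auto simp: abs_mult sgn_if)
  have "(\<integral>s. \<psi> s * sgn (s - a) \<partial>lborel) - (\<integral>s. \<psi> s * sgn s \<partial>lborel) =
      (\<integral>s. \<psi> s * sgn (s - a) - \<psi> s * sgn s \<partial>lborel)"
    using int'[of a] int'[of 0] by simp
  also have "\<dots> = (\<integral>s. (- 2 * sgn a) * (indicator {min 0 a..max 0 a} s * \<psi> s) \<partial>lborel)"
  proof (rule integral_cong_AE)
    show "AE s in lborel. \<psi> s * sgn (s - a) - \<psi> s * sgn s = (- 2 * sgn a) * (indicator {min 0 a..max 0 a} s * \<psi> s)"
      using AE_lborel_singleton[of 0] AE_lborel_singleton[of a]
      by eventually_elim (auto simp: sgn_if indicator_def)
  qed measurable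
  finally show ?thesis by simp
qed

text \<open>On the interval between \<open>0\<close> and \<open>a\<close>, \<open>\<psi>\<close> is
  replaced by the constant \<open>c\<close> with error \<open>e\<close>. The choice
  \<open>c = \<psi> 0\<close> yields the derivative at \<open>0\<close>, the choice
  \<open>c = 0\<close> a Lipschitz bound for domination.\<close>

lemma integral_sgn_shift_bound:
  fixes \<psi> :: "real \<Rightarrow> real"
  assumes int: "integrable lborel \<psi>" and e: "\<And>s. \<bar>s\<bar> \<le> \<bar>a\<bar> \<Longrightarrow> \<bar>\<psi> s - c\<bar> \<le> e"
  shows "\<bar>(\<integral>s. \<psi> s * sgn (s - a) \<partial>lborel) - (\<integral>s. \<psi> s * sgn s \<partial>lborel) + 2 * c * a\<bar> \<le> 2 * e * \<bar>a\<bar>"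
proof -
  let ?J = "{min 0 a..max 0 a}"
  have [measurable]: "\<psi> \<in> borel_measurable borel" using borel_measurable_integrable[OF int] by simp
  have J: "integrable lborel (\<lambda>s. indicator ?J s * b)" for b :: real by auto
  have J\<psi>: "integrable lborel (\<lambda>s. indicator ?J s * \<psi> s)"
    by (rule Bochner_Integration.integrable_bound[OF int]) (auto simp: abs_mult split: split_indicator)
  have len: "(\<integral>s. indicator ?J s * b \<partial>lborel) = \<bar>a\<bar> * b" for b
    by (cases "a \<ge> 0") auto
  have sgn_le: "\<bar>- 2 * sgn a * K\<bar> \<le> 2 * \<bar>K\<bar>" for K :: real
    by (simp add: sgn_if abs_mult)
  have "(\<integral>s. \<psi> s * sgn (s - a) \<partial>lborel) - (\<integral>s. \<psi> s * sgn s \<partial>lborel) + 2 * c * a =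
      - 2 * sgn a * ((\<integral>s. indicator ?J s * \<psi> s \<partial>lborel) - \<bar>a\<bar> * c)"
    unfolding integral_sgn_shift_diff[OF int] by (simp add: algebra_simps abs_sgn[of a] sgn_if)
  also have "(\<integral>s. indicator ?J s * \<psi> s \<partial>lborel) - \<bar>a\<bar> * c = (\<integral>s. indicator ?J s * (\<psi> s - c) \<partial>lborel)"
    unfolding len[symmetric] using J J\<psi> 
    by (subst Bochner_Integration.integral_diff[symmetric]) (auto simp: right_diff_distrib)
  finally have eq: "(\<integral>s. \<psi> s * sgn (s - a) \<partial>lborel) - (\<integral>s. \<psi> s * sgn s \<partial>lborel) + 2 * c * a =
      - 2 * sgn a * (\<integral>s. indicator ?J s * (\<psi> s - c) \<partial>lborel)" .
  have "\<bar>\<integral>s. indicator ?J s * (\<psi> s - c) \<partial>lborel\<bar> \<le> (\<integral>s. indicator ?J s * e \<partial>lborel)"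
  proof (rule integral_abs_bound_integral)
    show "integrable lborel (\<lambda>s. indicator ?J s * (\<psi> s - c))"
      using Bochner_Integration.integrable_diff[OF J\<psi> J[of c]] by (simp add: right_diff_distrib)
    fix s :: real
    have "s \<in> ?J \<Longrightarrow> \<bar>s\<bar> \<le> \<bar>a\<bar>" by auto
    then show "\<bar>indicator ?J s * (\<psi> s - c)\<bar> \<le> indicator ?J s * e"
      using e[of s] by (simp add: indicator_def)
  qed (rule J)
  then have "\<bar>\<integral>s. indicator ?J s * (\<psi> s - c) \<partial>lborel\<bar> \<le> \<bar>a\<bar> * e"
    by (simp only: len)
  then show ?thesis
    unfolding eq using sgn_le[of "\<integral>s. indicator ?J s * (\<psi> s - c) \<partial>lborel"]
    by (simp only: mult.assoc mult.commute[of e])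
qed

text \<open>The distributional derivative of the sign function is twice the Dirac mass. Continuity
  is asked at \<open>0\<close> alone, because the functions inserted later jump where a line leaves
  the unit ball.\<close>

lemma has_field_derivative_integral_sgn:
  fixes \<psi> :: "real \<Rightarrow> real"
  assumes int: "integrable lborel \<psi>" and cont: "isCont \<psi> 0"
  shows "((\<lambda>a. \<integral>s. \<psi> s * sgn (s - a) \<partial>lborel) has_field_derivative - 2 * \<psi> 0) (at 0)"
  unfolding has_field_derivative_def has_derivative_at_alt
proof (intro conjI allI impI)
  show "bounded_linear ((*) (- 2 * \<psi> 0))" by (rule bounded_linear_mult_right)
  fix e :: real assume e: "e > 0"
  \<comment> \<open>The tolerance \<open>e / 2\<close> absorbs the factor 2 in the shift
    bound.\<close>
  then obtain d where d: "d > 0" "\<And>s. \<bar>s\<bar> < d \<Longrightarrow> \<bar>\<psi> s - \<psi> 0\<bar> < e / 2"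
    using cont unfolding continuous_at_eps_delta by (auto simp: dist_real_def dest: spec[of _ "e/2"])
  have "\<bar>(\<integral>s. \<psi> s * sgn (s - a) \<partial>lborel) - (\<integral>s. \<psi> s * sgn s \<partial>lborel) + 2 * \<psi> 0 * a\<bar> \<le> 2 * (e / 2) * \<bar>a\<bar>"
    if "\<bar>a\<bar> < d" for a
    using that d(2) by (intro integral_sgn_shift_bound[OF int]) (force intro: less_imp_le)
  then show "\<exists>d>0. \<forall>y. norm (y - 0) < d \<longrightarrow>
      norm ((\<integral>s. \<psi> s * sgn (s - y) \<partial>lborel) - (\<integral>s. \<psi> s * sgn (s - 0) \<partial>lborel) - - 2 * \<psi> 0 * (y - 0)) \<le> e * norm (y - 0)"
    using d(1) by (intro exI[of _ d]) auto
qed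

section \<open>Fubini along a unit vector and null spheres\<close>

text \<open>The splitting of nonnegative integrals, applied to indicators, identifies
  \<open>lborel\<close> with an image of a product measure; signed integrands then fall under
  Fubini.\<close>

lemma lborel_eq_distr_split:
  fixes u :: "real^'n::{finite,wellorder}"
  assumes u: "norm u = 1"
  shows "lborel = distr (subspace_lborel {y. u \<bullet> y = 0} \<Otimes>\<^sub>M (lborel :: real measure)) borel (\<lambda>(z, s). s *\<^sub>R u + z)"
proof (rule measure_eqI)
  let ?L = "subspace_lborel {y. u \<bullet> y = 0}"
  have [measurable]: "(\<lambda>(z, s). s *\<^sub>R u + z) \<in> borel_measurable (?L \<Otimes>\<^sub>M (lborel :: real measure))"
    by measurable
  fix A :: "(real^'n::_) set" assume "A \<in> sets lborel"
  then have [measurable]: "A \<in> sets borel" by simp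
  have "emeasure lborel A = (\<integral>\<^sup>+ y. indicator A y \<partial>lborel)" by simp
  also have "\<dots> = (\<integral>\<^sup>+ z. (\<integral>\<^sup>+ s. indicator A (s *\<^sub>R u + z) \<partial>lborel) \<partial>?L)"
    by (rule nn_integral_lborel_split[OF u]) simp
  also have "\<dots> = (\<integral>\<^sup>+ x. indicator A (case x of (z, s) \<Rightarrow> s *\<^sub>R u + z) \<partial>(?L \<Otimes>\<^sub>M lborel))"
    by (subst lborel.nn_integral_fst[symmetric]) auto
  also have "\<dots> = emeasure (distr (?L \<Otimes>\<^sub>M lborel) borel (\<lambda>(z, s). s *\<^sub>R u + z)) A"
    by (subst nn_integral_indicator[symmetric], simp, subst nn_integral_distr) auto
  finally show "emeasure lborel A = \<dots>" .
qed simp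

lemma integral_lborel_split:
  fixes u :: "real^'n::{finite,wellorder}" and G :: "real^'n::_ \<Rightarrow> real"
  assumes u: "norm u = 1" and G: "integrable lborel G"
  shows "integrable (subspace_lborel {y. u \<bullet> y = 0}) (\<lambda>z. \<integral>s. G (s *\<^sub>R u + z) \<partial>lborel)" (is ?int)
    and "(\<integral>y. G y \<partial>lborel) = (\<integral>z. (\<integral>s. G (s *\<^sub>R u + z) \<partial>lborel) \<partial>subspace_lborel {y. u \<bullet> y = 0})" (is ?eq)
proof -
  let ?L = "subspace_lborel {y. u \<bullet> y = 0}"
  interpret L: sigma_finite_measure ?L by (rule sigma_finite_subspace_lborel[OF u])
  interpret P: pair_sigma_finite ?L "lborel :: real measure" ..
  have [measurable]: "(\<lambda>(z, s). s *\<^sub>R u + z) \<in> borel_measurable (?L \<Otimes>\<^sub>M (lborel :: real measure))"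
    by measurable
  have [measurable]: "G \<in> borel_measurable borel" using borel_measurable_integrable[OF G] by simp
  have int: "integrable (?L \<Otimes>\<^sub>M lborel) (\<lambda>(z, s). G (s *\<^sub>R u + z))"
    using G by (subst (asm) lborel_eq_distr_split[OF u], subst (asm) integrable_distr_eq)
      (auto simp: case_prod_unfold)
  show ?int using P.integrable_fst[OF int] by simp
  have "(\<integral>y. G y \<partial>lborel) = (\<integral>(z, s). G (s *\<^sub>R u + z) \<partial>(?L \<Otimes>\<^sub>M lborel))"
    by (subst lborel_eq_distr_split[OF u], subst integral_distr) (auto simp: case_prod_unfold)
  then show ?eq using P.integral_fst[OF int] by simp
qed

text \<open>For every \<open>r < 1\<close> the unit sphere lies in the shell between the balls of
  radius \<open>r\<close> and 1, whose mass \<open>m - r ^ (CARD('n) - 1) * m\<close> tends to 0 as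
  \<open>r\<close> tends to 1. This excludes the lines through points \<open>z\<close> at which the
  function cut off at the unit ball may jump.\<close>

lemma AE_subspace_lborel_norm_neq_1:
  fixes u :: "real^'n::{finite,wellorder}"
  assumes u: "norm u = 1"
  shows "AE z in subspace_lborel {y. u \<bullet> y = 0}. norm z \<noteq> 1"
proof -
  let ?L = "subspace_lborel {y. u \<bullet> y = 0}"
  define m where "m = measure ?L (cball 0 1)"
  have fin: "emeasure ?L (cball 0 r) \<noteq> \<infinity>" for r
    using emeasure_subspace_lborel_cball[OF u, of r] by (simp add: less_top)
  have sph: "sphere 0 1 = cball 0 1 - ball (0::real^'n::_) 1" by auto
  have le: "measure ?L (sphere 0 1) \<le> m - r ^ (CARD('n) - 1) * m" if r: "0 < r" "r < 1" for r :: real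
  proof -
    have [measurable]: "cball (0::real^'n::_) r \<in> sets borel" by simp
    have "measure ?L (cball 0 r) = (\<integral>z. indicator (cball 0 r) z \<partial>?L)" by simp
    also have "\<dots> = r ^ (CARD('n) - 1) * (\<integral>z. indicator (cball 0 r) (r *\<^sub>R z) \<partial>?L)"
      using r by (intro integral_subspace_lborel_scale[OF u]) measurable
    also have "(\<lambda>z. indicator (cball 0 r) (r *\<^sub>R z)) = (indicator (cball 0 1) :: real^'n::_ \<Rightarrow> real)"
      using r by (auto simp: fun_eq_iff split: split_indicator)
    finally have "measure ?L (cball 0 r) = r ^ (CARD('n) - 1) * m" by (simp add: m_def)
    moreover have "measure ?L (sphere 0 1) \<le> measure ?L (cball 0 1 - cball 0 r)"
    proof (rule measure_mono_fmeasurable)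
      show "cball 0 1 - cball 0 r \<in> fmeasurable ?L"
        using fin[of 1] fin[of r] by (intro fmeasurable.Diff fmeasurableI) (auto simp: less_top)
    qed (use r in auto)
    moreover have "measure ?L (cball 0 1 - cball 0 r) = measure ?L (cball 0 1) - measure ?L (cball 0 r)"
      using r fin[of 1] fin[of r] by (intro measure_Diff) auto
    ultimately show ?thesis by (simp add: m_def)
  qed
  have "measure ?L (sphere 0 1) \<le> 0"
  proof (rule tendsto_lowerbound)
    have "((\<lambda>r. m - r ^ (CARD('n) - 1) * m) \<longlongrightarrow> m - 1 ^ (CARD('n) - 1) * m) (at_left 1)"
      by (intro tendsto_intros)
    then show "((\<lambda>r. m - r ^ (CARD('n) - 1) * m) \<longlongrightarrow> 0) (at_left 1)" by simp
    show "\<forall>\<^sub>F r in at_left 1. measure ?L (sphere 0 1) \<le> m - r ^ (CARD('n) - 1) * m"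
      using eventually_at_left_real[of 0 "1::real"] le by (auto elim!: eventually_mono)
  qed simp
  moreover have "emeasure ?L (sphere 0 1) \<noteq> \<infinity>"
    using emeasure_mono[of "sphere 0 1" "cball 0 1" ?L] fin[of 1] by (auto simp: top_unique)
  ultimately have "emeasure ?L (sphere 0 1) = 0"
    by (simp add: emeasure_eq_ennreal_measure measure_le_0_iff)
  then have "sphere 0 1 \<in> null_sets ?L" by auto
  then show ?thesis by (rule AE_mp[OF AE_not_in]) auto
qed

section \<open>The derivative that localizes on the orthogonal hyperplane\<close>

text \<open>Formally, the derivative of \<open>sgn (x \<bullet> \<xi>)\<close> in direction
  \<open>v\<close> is \<open>v \<bullet> \<xi>\<close> times twice the Dirac mass of
  \<open>x \<bullet> \<xi>\<close>; this mass lives on the equator orthogonal to \<open>x\<close>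
  with density \<open>1 / norm x\<close>.\<close>

lemma has_field_derivative_integral_sgn_sphere:
  fixes x v :: "real^'n::{finite,wellorder}" and g :: "real^'n::_ \<Rightarrow> real"
  assumes x: "x \<noteq> 0" and g: "continuous_on (sphere 0 1) g"
  shows "((\<lambda>t. \<integral>\<xi>. sgn ((x + t *\<^sub>R v) \<bullet> \<xi>) * g \<xi> \<partial>sphere_measure UNIV) has_field_derivative
    2 / norm x * (\<integral>\<xi>. (v \<bullet> \<xi>) * g \<xi> \<partial>sphere_measure {y. x \<bullet> y = 0})) (at 0)"
proof -
  define u where "u = x /\<^sub>R norm x"
  have u: "norm u = 1" using x by (simp add: u_def)
  then have uu: "u \<bullet> u = 1" by (simp add: dot_square_norm)
  have xu: "x = norm x *\<^sub>R u" using x by (simp add: u_def)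
  have V: "{y. x \<bullet> y = 0} = {y. u \<bullet> y = 0}" using x by (simp add: u_def)
  let ?L = "subspace_lborel {y. u \<bullet> y = 0}"
  note gm = borel_measurable_continuous_on_restrict[OF g]
  note [measurable] = borel_measurable_radial_ext[OF gm]
  obtain C where C: "C > 0" "\<And>\<xi>. norm \<xi> = 1 \<Longrightarrow> \<bar>g \<xi>\<bar> \<le> C"
    using sphere_bounded_obtain[OF g] by blast
  define \<phi> where "\<phi> y = indicator (cball 0 1) y * radial_ext g y" for y
  have \<phi>m [measurable]: "\<phi> \<in> borel_measurable borel"
    unfolding \<phi>_def[abs_def] by (rule borel_measurable_cball_radial_ext[OF gm])
  have \<phi>C: "\<bar>\<phi> y\<bar> \<le> C" for y
    using sphere_bounded_radial_ext[where h=g and z=y, OF C(2) C(1)] C(1)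
    by (auto simp: \<phi>_def indicator_def)
  define G where "G t y = \<phi> y * sgn ((x + t *\<^sub>R v) \<bullet> y)" for t y
  have Gm [measurable]: "G t \<in> borel_measurable borel" for t
    unfolding G_def[abs_def] by measurable
  have Gint: "integrable lborel (G t)" for t
  proof (rule integrableI_bounded_set[where A="cball 0 1" and B=C])
    show "emeasure lborel (cball (0::real^'n::_) 1) < \<infinity>"
      by (rule emeasure_bounded_finite) simp
    show "AE y in lborel. y \<in> cball 0 1 \<longrightarrow> norm (G t y) \<le> C"
      using \<phi>C C(1) by (intro AE_I2) (auto simp: G_def abs_mult sgn_if)
  qed (auto simp: G_def \<phi>_def)
  have sphere_eq: "(\<integral>\<xi>. sgn ((x + t *\<^sub>R v) \<bullet> \<xi>) * g \<xi> \<partial>sphere_measure UNIV) =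
      CARD('n) * (\<integral>z. (\<integral>s. G t (s *\<^sub>R u + z) \<partial>lborel) \<partial>?L)" for t
  proof -
    let ?h = "\<lambda>\<xi>. sgn ((x + t *\<^sub>R v) \<bullet> \<xi>) * g \<xi>"
    have hm: "?h \<in> borel_measurable (restrict_space borel (sphere 0 1))"
      by (intro borel_measurable_times gm measurable_restrict_space1) measurable
    have "radial_ext ?h y = sgn ((x + t *\<^sub>R v) \<bullet> y) * radial_ext g y" for y
      by (simp add: radial_ext_def sgn_div_norm[of y] sgn_mult)
    then have "(\<integral>\<xi>. ?h \<xi> \<partial>sphere_measure UNIV) = CARD('n) * (\<integral>y. G t y \<partial>lborel)"
      by (subst integral_sphere_measure[OF subspace_UNIV hm])
         (simp add: subspace_lborel_UNIV G_def[abs_def] \<phi>_def mult_ac)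
    then show ?thesis by (simp add: integral_lborel_split(2)[OF u Gint])
  qed
  \<comment> \<open>For \<open>\<bar>t\<bar> < d\<close> the perturbation changes the component
    along \<open>u\<close> by less than \<open>norm x / 2\<close>; the summand 1 keeps the quotient
    meaningful when \<open>v = 0\<close>.\<close>
  define d where "d = norm x / (2 * (norm v + 1))"
  have d: "d > 0" using x by (simp add: d_def add_nonneg_pos)
  \<comment> \<open>\<open>D t\<close> is the component of \<open>x + t *\<^sub>R v\<close> along
    \<open>u\<close>, that is, the coefficient of \<open>s\<close> in its product with
    \<open>s *\<^sub>R u + z\<close>; \<open>a t z\<close> below is the zero of that affine function
    of \<open>s\<close>.\<close>
  define D where "D t = norm x + t * (v \<bullet> u)" for t
  have D: "D t > norm x / 2" if "\<bar>t\<bar> < d" for t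
  proof -
    have "\<bar>t * (v \<bullet> u)\<bar> \<le> \<bar>t\<bar> * (norm v + 1)"
      using Cauchy_Schwarz_ineq2[of v u] u by (auto simp: abs_mult intro!: mult_left_mono)
    also have "\<dots> < d * (norm v + 1)" using that by (intro mult_strict_right_mono) (auto simp: add_nonneg_pos)
    also have "\<dots> = norm x / 2"
    proof -
      have "norm v + 1 \<noteq> 0" using norm_ge_zero[of v] by linarith
      moreover have "c \<noteq> 0 \<Longrightarrow> r / (2 * c) * c = r / 2" for c r :: real by simp
      ultimately show ?thesis unfolding d_def by blast
    qed
    finally show ?thesis by (simp add: D_def abs_less_iff)
  qed
  define a where "a t z = - (t * (v \<bullet> z)) / D t" for t z
  define \<psi> where "\<psi> z s = \<phi> (s *\<^sub>R u + z)" for z s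
  have \<psi>C: "\<bar>\<psi> z s\<bar> \<le> C" for z s by (simp add: \<psi>_def \<phi>C)
  have norm_split: "norm z \<le> norm (s *\<^sub>R u + z)" "\<bar>s\<bar> \<le> norm (s *\<^sub>R u + z)" if "u \<bullet> z = 0" for s z
  proof -
    have "(norm (s *\<^sub>R u + z))\<^sup>2 = (norm (s *\<^sub>R u))\<^sup>2 + (norm z)\<^sup>2"
      using that by (intro norm_add_Pythagorean) (simp add: orthogonal_def)
    then have "(norm (s *\<^sub>R u + z))\<^sup>2 = s\<^sup>2 + (norm z)\<^sup>2" by (simp add: u)
    then have "(norm z)\<^sup>2 \<le> (norm (s *\<^sub>R u + z))\<^sup>2" "\<bar>s\<bar>\<^sup>2 \<le> (norm (s *\<^sub>R u + z))\<^sup>2" by auto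
    then show "norm z \<le> norm (s *\<^sub>R u + z)" "\<bar>s\<bar> \<le> norm (s *\<^sub>R u + z)"
      by (auto intro: power2_le_imp_le)
  qed
  have \<psi>int: "integrable lborel (\<psi> z)" if z: "u \<bullet> z = 0" for z
  proof (rule integrableI_bounded_set[where A="{-1..1}" and B=C])
    have "\<psi> z s = 0" if "s \<notin> {-1..1}" for s
      using that norm_split(2)[OF z, of s] by (auto simp: \<psi>_def \<phi>_def indicator_def)
    then show "AE s in lborel. s \<notin> {-1..1} \<longrightarrow> \<psi> z s = 0" by auto
    show "\<psi> z \<in> borel_measurable lborel" unfolding \<psi>_def[abs_def] by measurable
  qed (auto simp: \<psi>C)
  define F where "F t z = (\<integral>s. G t (s *\<^sub>R u + z) \<partial>lborel)" for t z
  have F: "F t z = (\<integral>s. \<psi> z s * sgn (s - a t z) \<partial>lborel)" if t: "\<bar>t\<bar> < d" and z: "u \<bullet> z = 0" for t z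
  proof -
    have Dpos: "D t > 0" using D[OF t] by (rule le_less_trans[rotated]) simp
    have xz: "x \<bullet> z = 0" using z by (subst xu) simp
    have xx: "x \<bullet> u = norm x" by (subst xu) (simp add: uu)
    have "(x + t *\<^sub>R v) \<bullet> (s *\<^sub>R u + z) = D t * (s - a t z)" for s
      using Dpos by (simp add: inner_simps xz xx a_def D_def[symmetric] field_simps)
    then have "sgn ((x + t *\<^sub>R v) \<bullet> (s *\<^sub>R u + z)) = sgn (s - a t z)" for s
      using Dpos by (simp add: sgn_mult)
    then show ?thesis by (simp add: F_def G_def \<psi>_def)
  qed
  have a0 [simp]: "a 0 z = 0" for z by (simp add: a_def)
  have Lperp: "AE z in ?L. u \<bullet> z = 0"
    using AE_subspace_lborel[OF subspace_hyperplane[of u]] by simp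
  have meas: "(\<lambda>z. 2 / norm x * ((v \<bullet> z) * \<phi> z)) \<in> borel_measurable ?L" by measurable
  have "((\<lambda>t. \<integral>z. F t z \<partial>?L) has_field_derivative (\<integral>z. 2 / norm x * ((v \<bullet> z) * \<phi> z) \<partial>?L)) (at 0)"
  proof (rule has_field_derivative_integral[OF d _ meas])
    show "integrable ?L (F t)" for t
      unfolding F_def[abs_def] by (rule integral_lborel_split(1)[OF u Gint])
    \<comment> \<open>The constant combines \<open>2 * C * \<bar>a t z\<bar>\<close> from the shift
      bound with \<open>\<bar>a t z\<bar> \<le> 2 * \<bar>t\<bar> * norm v / norm x\<close>. For
      \<open>norm z > 1\<close> the line through \<open>z\<close> misses the ball, so the integrand
      vanishes.\<close>
    show "integrable ?L (\<lambda>z. indicator (cball 0 1) z * (4 * C * norm v / norm x))"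
      using emeasure_subspace_lborel_cball[OF u, of 1] by (intro integrable_mult_left integrable_real_indicator) auto
    show "AE z in ?L. \<bar>F t z - F 0 z\<bar> \<le> \<bar>t\<bar> * (indicator (cball 0 1) z * (4 * C * norm v / norm x))"
      if t: "\<bar>t\<bar> < d" for t
      using Lperp
    proof eventually_elim
      case (elim z)
      show ?case
      proof (cases "norm z \<le> 1")
        case True
        have "\<bar>F t z - F 0 z\<bar> \<le> 2 * C * \<bar>a t z\<bar>"
          using integral_sgn_shift_bound[OF \<psi>int[OF elim], of "a t z" 0 C] \<psi>C
          by (simp add: F[OF t elim] F[of 0, OF _ elim] d)
        also have "\<bar>a t z\<bar> \<le> \<bar>t\<bar> * norm v / (norm x / 2)"
        proof -
          have "\<bar>v \<bullet> z\<bar> \<le> norm v * 1"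
            using Cauchy_Schwarz_ineq2[of v z] True by (metis mult_left_mono norm_ge_zero order_trans)
          then have "\<bar>t\<bar> * \<bar>v \<bullet> z\<bar> / D t \<le> \<bar>t\<bar> * norm v / (norm x / 2)"
            using D[OF t] x by (intro frac_le mult_left_mono) auto
          moreover have "D t > 0" using D[OF t] by (rule le_less_trans[rotated]) simp
          ultimately show ?thesis by (simp add: a_def abs_mult)
        qed
        finally show ?thesis using True C(1) by (simp add: mult_ac)
      next
        case False
        then have "\<psi> z s = 0" for s
          using norm_split(1)[OF elim, of s] by (simp add: \<psi>_def \<phi>_def indicator_def)
        then have "F t z = 0" "F 0 z = 0" using t d by (simp_all add: F[OF _ elim])
        then show ?thesis using False by simp
      qed
    qed
    show "AE z in ?L. ((\<lambda>t. F t z) has_field_derivative 2 / norm x * ((v \<bullet> z) * \<phi> z)) (at 0)"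
      using Lperp AE_subspace_lborel_norm_neq_1[OF u]
    proof eventually_elim
      case (elim z)
      have "((\<lambda>t. \<integral>s. \<psi> z s * sgn (s - a t z) \<partial>lborel) has_field_derivative 2 / norm x * ((v \<bullet> z) * \<phi> z)) (at 0)"
      \<comment> \<open>At the origin \<open>\<phi>\<close> need not be continuous, but there
        \<open>a t z = 0\<close> for all \<open>t\<close> and the claimed derivative is zero.
        Elsewhere off the unit sphere \<open>\<phi>\<close> is continuous.\<close>
      proof (cases "z = 0")
        case True
        then show ?thesis by (simp add: a_def)
      next
        case False
        have "isCont \<phi> z"
        proof (cases "norm z < 1")
          case True
          have "continuous_on (ball 0 1 - {0}) \<phi>"
            by (rule continuous_on_eq[OF continuous_on_subset[OF continuous_on_radial_ext[OF g]]])
               (auto simp: \<phi>_def)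
          then show ?thesis
            using True False by (subst (asm) continuous_on_eq_continuous_at) auto
        next
          case False
          have "continuous_on (- cball 0 1) \<phi>"
            by (rule continuous_on_eq[OF continuous_on_const[of _ 0]]) (auto simp: \<phi>_def)
          then show ?thesis
            using False elim by (subst (asm) continuous_on_eq_continuous_at) auto
        qed
        then have "isCont (\<psi> z) 0"
          unfolding \<psi>_def[abs_def]
          by (intro isCont_o2[where g=\<phi>, of _ "\<lambda>s. s *\<^sub>R u + z"]) (auto intro!: continuous_intros)
        note der = has_field_derivative_integral_sgn[OF \<psi>int[OF elim(1)] this]
        have "((\<lambda>t. a t z) has_field_derivative - (v \<bullet> z) / norm x) (at 0)"
          unfolding a_def D_def using x
          by (auto intro!: derivative_eq_intros simp: power2_eq_square)
        from DERIV_chain2[of "\<lambda>a. \<integral>s. \<psi> z s * sgn (s - a) \<partial>lborel" "- 2 * \<psi> z 0" "\<lambda>t. a t z", OF _ this] der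
        have "((\<lambda>t. \<integral>s. \<psi> z s * sgn (s - a t z) \<partial>lborel) has_field_derivative
            - 2 * \<psi> z 0 * (- (v \<bullet> z) / norm x)) (at 0)" by simp
        also have "- 2 * \<psi> z 0 * (- (v \<bullet> z) / norm x) = 2 / norm x * ((v \<bullet> z) * \<phi> z)"
          by (simp add: \<psi>_def)
        finally show ?thesis .
      qed
      then show ?case
        by (rule has_field_derivative_transform_within_open[of _ _ _ "{-d<..<d}"])
           (use d in \<open>auto simp: F[OF _ elim(1)]\<close>)
    qed
  qed
  then have "((\<lambda>t. \<integral>\<xi>. sgn ((x + t *\<^sub>R v) \<bullet> \<xi>) * g \<xi> \<partial>sphere_measure UNIV) has_field_derivative
      CARD('n) * (\<integral>z. 2 / norm x * ((v \<bullet> z) * \<phi> z) \<partial>?L)) (at 0)"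
    unfolding sphere_eq F_def by (rule DERIV_cmult)
  moreover have "CARD('n) * (\<integral>z. 2 / norm x * ((v \<bullet> z) * \<phi> z) \<partial>?L) =
      2 / norm x * (\<integral>\<xi>. (v \<bullet> \<xi>) * g \<xi> \<partial>sphere_measure {y. u \<bullet> y = 0})"
  proof -
    have h: "continuous_on (sphere 0 1) (\<lambda>\<xi>. (v \<bullet> \<xi>) * g \<xi>)"
      using g by (intro continuous_intros)
    have dim: "dim {y. u \<bullet> y = 0} = CARD('n) - 1"
      using u by (subst dim_hyperplane) auto
    \<comment> \<open>The linear factor \<open>v \<bullet> z\<close> is not constant on rays;
      writing it as \<open>norm z * (v \<bullet> sgn z)\<close> produces the weight
      \<open>norm z\<close>.\<close>
    have "(v \<bullet> z) * \<phi> z = indicator (cball 0 1) z * (norm z * radial_ext (\<lambda>\<xi>. (v \<bullet> \<xi>) * g \<xi>) z)" for z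
      by (simp add: \<phi>_def radial_ext_def sgn_div_norm[of z])
    then have "CARD('n) * (\<integral>z. 2 / norm x * ((v \<bullet> z) * \<phi> z) \<partial>?L) = 2 / norm x *
        (CARD('n) * (\<integral>z. indicator (cball 0 1) z * (norm z * radial_ext (\<lambda>\<xi>. (v \<bullet> \<xi>) * g \<xi>) z) \<partial>?L))"
      by simp
    \<comment> \<open>The weight \<open>norm z\<close> turns the factor \<open>CARD('n)\<close>,
      from the cone formula of the full sphere, into \<open>CARD('n) - 1\<close>, the dimension in
      the cone formula of the equator.\<close>
    also have "\<dots> = 2 / norm x * (\<integral>\<xi>. (v \<bullet> \<xi>) * g \<xi> \<partial>sphere_measure {y. u \<bullet> y = 0})"
      unfolding integral_norm_radial_ext[OF u h]
      by (subst integral_sphere_measure[OF subspace_hyperplane borel_measurable_continuous_on_restrict[OF h]])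
         (simp add: dim)
    finally show ?thesis .
  qed
  ultimately show ?thesis by (simp only: V)
qed

section \<open>Derivatives under the integral sign and continuity\<close>

text \<open>Induction by the product rule for differences; the constant is the bound of the
  derivative on \<open>[-R, R]\<close>. The estimate also crosses \<open>0\<close>, where the sign
  changes, and so dominates the difference quotients of \<open>s ^ Suc m * sgn s\<close>.\<close>

lemma power_abs_lipschitz:
  fixes s s' R :: real
  assumes "\<bar>s\<bar> \<le> R" "\<bar>s'\<bar> \<le> R"
  shows "\<bar>s ^ m * \<bar>s\<bar> - s' ^ m * \<bar>s'\<bar>\<bar> \<le> real (Suc m) * R ^ m * \<bar>s - s'\<bar>"
proof (induction m)
  case 0
  then show ?case by simp
next
  case (Suc m)
  have "s ^ Suc m * \<bar>s\<bar> - s' ^ Suc m * \<bar>s'\<bar> =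
      s * (s ^ m * \<bar>s\<bar> - s' ^ m * \<bar>s'\<bar>) + (s - s') * (s' ^ m * \<bar>s'\<bar>)"
    by (simp add: algebra_simps)
  also have "\<bar>\<dots>\<bar> \<le> \<bar>s\<bar> * \<bar>s ^ m * \<bar>s\<bar> - s' ^ m * \<bar>s'\<bar>\<bar> + \<bar>s - s'\<bar> * (\<bar>s'\<bar> ^ m * \<bar>s'\<bar>)"
    by (rule order_trans[OF abs_triangle_ineq]) (simp add: abs_mult power_abs)
  also have "\<dots> \<le> R * (real (Suc m) * R ^ m * \<bar>s - s'\<bar>) + \<bar>s - s'\<bar> * (R ^ m * R)"
    using assms Suc by (intro add_mono mult_mono power_mono) auto
  also have "\<dots> = real (Suc (Suc m)) * R ^ Suc m * \<bar>s - s'\<bar>"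
    by (simp add: algebra_simps)
  finally show ?case .
qed

lemma has_field_derivative_power_sgn:
  fixes s :: real
  assumes "s \<noteq> 0"
  shows "((\<lambda>s. s ^ Suc m * sgn s) has_field_derivative real (Suc m) * s ^ m * sgn s) (at s)"
proof -
  have "((\<lambda>s. s ^ Suc m * c) has_field_derivative real (Suc m) * s ^ m * c) (at s)" for c
    using DERIV_cmult_right[OF DERIV_pow[of "Suc m" s]] by simp
  then show ?thesis
    by (rule has_field_derivative_transform_within_open[of _ _ _ "if s > 0 then {0<..} else {..<0}"])
       (use assms in \<open>auto split: if_splits\<close>)
qed

text \<open>The kernel is Lipschitz on bounded intervals and differentiable off \<open>0\<close>,
  and \<open>x \<bullet> \<xi> = 0\<close> only on a null set of the sphere.\<close>

lemma has_field_derivative_integral_power_sgn_sphere: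
  fixes x v :: "real^'n::{finite,wellorder}" and h :: "real^'n::_ \<Rightarrow> real"
  assumes x: "x \<noteq> 0" and h: "continuous_on (sphere 0 1) h"
  shows "((\<lambda>t. \<integral>\<xi>. ((x + t *\<^sub>R v) \<bullet> \<xi>) ^ Suc m * sgn ((x + t *\<^sub>R v) \<bullet> \<xi>) * h \<xi> \<partial>sphere_measure UNIV)
    has_field_derivative
    real (Suc m) * (\<integral>\<xi>. (x \<bullet> \<xi>) ^ m * sgn (x \<bullet> \<xi>) * ((v \<bullet> \<xi>) * h \<xi>) \<partial>sphere_measure UNIV)) (at 0)"
proof -
  let ?M = "sphere_measure (UNIV :: (real^'n::_) set)"
  interpret M: finite_measure ?M by (rule finite_sphere_measure_UNIV)
  obtain C where C: "C > 0" "\<And>\<xi>. norm \<xi> = 1 \<Longrightarrow> \<bar>h \<xi>\<bar> \<le> C"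
    using sphere_bounded_obtain[OF h] by blast
  have hm [measurable]: "h \<in> borel_measurable ?M"
    by (rule borel_measurable_sphere[OF borel_measurable_continuous_on_restrict[OF h]])
  have im [measurable]: "(\<lambda>\<xi>. w \<bullet> \<xi>) \<in> borel_measurable ?M" for w
    by (intro borel_measurable_sphere borel_measurable_continuous_on_restrict continuous_intros)
  \<comment> \<open>\<open>R\<close> bounds the arguments of the kernel for all
    \<open>\<bar>t\<bar> < 1\<close> and all unit vectors.\<close>
  define R where "R = norm x + norm v"
  have R: "\<bar>(x + t *\<^sub>R v) \<bullet> \<xi>\<bar> \<le> R" if "\<bar>t\<bar> < 1" "norm \<xi> = 1" for t \<xi>
  proof -
    have "\<bar>(x + t *\<^sub>R v) \<bullet> \<xi>\<bar> \<le> norm (x + t *\<^sub>R v)"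
      using Cauchy_Schwarz_ineq2[of "x + t *\<^sub>R v" \<xi>] that by simp
    also have "\<dots> \<le> norm x + \<bar>t\<bar> * norm v" using norm_triangle_ineq[of x "t *\<^sub>R v"] by simp
    also have "\<dots> \<le> R" using that by (simp add: R_def mult_left_le_one_le)
    finally show ?thesis .
  qed
  have sphere: "norm \<xi> = 1" if "\<xi> \<in> space ?M" for \<xi> using that by simp
  have abs: "s ^ Suc m * sgn s = s ^ m * \<bar>s\<bar>" for s :: real by (simp add: abs_sgn mult_ac)
  have "((\<lambda>t. \<integral>\<xi>. ((x + t *\<^sub>R v) \<bullet> \<xi>) ^ Suc m * sgn ((x + t *\<^sub>R v) \<bullet> \<xi>) * h \<xi> \<partial>?M)
    has_field_derivative
    (\<integral>\<xi>. real (Suc m) * ((x \<bullet> \<xi>) ^ m * sgn (x \<bullet> \<xi>) * ((v \<bullet> \<xi>) * h \<xi>)) \<partial>?M)) (at 0)"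
  proof (rule has_field_derivative_integral[where d=1])
    show "integrable ?M (\<lambda>\<xi>. ((x + t *\<^sub>R v) \<bullet> \<xi>) ^ Suc m * sgn ((x + t *\<^sub>R v) \<bullet> \<xi>) * h \<xi>)"
      if t: "\<bar>t\<bar> < 1" for t
    proof (rule M.integrable_const_bound[where B="R ^ m * R * C"])
      show "AE \<xi> in ?M. norm (((x + t *\<^sub>R v) \<bullet> \<xi>) ^ Suc m * sgn ((x + t *\<^sub>R v) \<bullet> \<xi>) * h \<xi>) \<le> R ^ m * R * C"
        unfolding abs abs_mult power_abs real_norm_def abs_idempotent
        by (intro AE_I2 mult_mono power_mono R C(2) sphere t mult_nonneg_nonneg zero_le_power)
           (auto simp: R_def)
    qed measurable
    show "integrable ?M (\<lambda>\<xi>. real (Suc m) * R ^ m * norm v * C)" by simp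
    show "AE \<xi> in ?M. \<bar>((x + t *\<^sub>R v) \<bullet> \<xi>) ^ Suc m * sgn ((x + t *\<^sub>R v) \<bullet> \<xi>) * h \<xi> -
        ((x + 0 *\<^sub>R v) \<bullet> \<xi>) ^ Suc m * sgn ((x + 0 *\<^sub>R v) \<bullet> \<xi>) * h \<xi>\<bar> \<le> \<bar>t\<bar> * (real (Suc m) * R ^ m * norm v * C)"
      if t: "\<bar>t\<bar> < 1" for t
    proof (rule AE_I2)
      fix \<xi> assume "\<xi> \<in> space ?M"
      then have \<xi>: "norm \<xi> = 1" by simp
      let ?s = "(x + t *\<^sub>R v) \<bullet> \<xi>" and ?s' = "(x + 0 *\<^sub>R v) \<bullet> \<xi>"
      have "\<bar>?s ^ Suc m * sgn ?s * h \<xi> - ?s' ^ Suc m * sgn ?s' * h \<xi>\<bar> =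
          \<bar>?s ^ m * \<bar>?s\<bar> - ?s' ^ m * \<bar>?s'\<bar>\<bar> * \<bar>h \<xi>\<bar>"
        unfolding abs by (simp add: left_diff_distrib[symmetric] abs_mult)
      also have "\<dots> \<le> (real (Suc m) * R ^ m * \<bar>?s - ?s'\<bar>) * C"
        using R[OF t \<xi>] R[of 0, OF _ \<xi>] C \<xi>
        by (intro mult_mono power_abs_lipschitz) (auto simp: R_def)
      also have "\<dots> \<le> (real (Suc m) * R ^ m * (\<bar>t\<bar> * norm v)) * C"
      proof (intro mult_right_mono mult_left_mono)
        show "\<bar>?s - ?s'\<bar> \<le> \<bar>t\<bar> * norm v"
          using Cauchy_Schwarz_ineq2[of v \<xi>] \<xi> by (simp add: inner_simps abs_mult mult_left_mono)
      qed (use C(1) in \<open>auto simp: R_def\<close>)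
      also have "\<dots> = \<bar>t\<bar> * (real (Suc m) * R ^ m * norm v * C)"
        by (simp only: mult_ac)
      finally show "\<bar>?s ^ Suc m * sgn ?s * h \<xi> - ?s' ^ Suc m * sgn ?s' * h \<xi>\<bar> \<le>
          \<bar>t\<bar> * (real (Suc m) * R ^ m * norm v * C)" .
    qed
    show "AE \<xi> in ?M. ((\<lambda>t. ((x + t *\<^sub>R v) \<bullet> \<xi>) ^ Suc m * sgn ((x + t *\<^sub>R v) \<bullet> \<xi>) * h \<xi>) has_field_derivative
        real (Suc m) * ((x \<bullet> \<xi>) ^ m * sgn (x \<bullet> \<xi>) * ((v \<bullet> \<xi>) * h \<xi>))) (at 0)"
      using AE_sphere_measure_inner_nonzero[OF x]
    proof eventually_elim
      case (elim \<xi>)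
      have "((\<lambda>t. (x + t *\<^sub>R v) \<bullet> \<xi>) has_field_derivative v \<bullet> \<xi>) (at 0)"
        unfolding inner_add_left inner_scaleR_left by (auto intro!: derivative_eq_intros)
      from DERIV_chain2[of "\<lambda>s. s ^ Suc m * sgn s" _ "\<lambda>t. (x + t *\<^sub>R v) \<bullet> \<xi>", OF _ this]
        has_field_derivative_power_sgn[of "x \<bullet> \<xi>" m] elim
      have "((\<lambda>t. ((x + t *\<^sub>R v) \<bullet> \<xi>) ^ Suc m * sgn ((x + t *\<^sub>R v) \<bullet> \<xi>)) has_field_derivative
          real (Suc m) * (x \<bullet> \<xi>) ^ m * sgn (x \<bullet> \<xi>) * (v \<bullet> \<xi>)) (at 0)"
        by simp
      from DERIV_cmult_right[OF this, of "h \<xi>"] show ?case by (simp only: mult.assoc)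
    qed
  qed measurable
  then show ?thesis by simp
qed

text \<open>Dominated convergence: for fixed \<open>\<xi>\<close> the integrand is continuous at
  \<open>x\<close> unless \<open>x \<bullet> \<xi> = 0\<close>, which is a null event precisely
  because \<open>x \<noteq> 0\<close>.\<close>

lemma continuous_on_integral_power_sgn_sphere:
  fixes h :: "real^'n::{finite,wellorder} \<Rightarrow> real"
  assumes h: "continuous_on (sphere 0 1) h"
  shows "continuous_on (UNIV - {0}) (\<lambda>x. \<integral>\<xi>. (x \<bullet> \<xi>) ^ m * sgn (x \<bullet> \<xi>) * h \<xi> \<partial>sphere_measure UNIV)"
  unfolding continuous_on_sequentially comp_def
proof (intro allI ballI impI, elim conjE)
  fix X :: "nat \<Rightarrow> real^'n::_" and x
  assume x: "x \<in> UNIV - {0}" and X: "X \<longlonglongrightarrow> x" and "\<forall>n. X n \<in> UNIV - {0}"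
  let ?M = "sphere_measure (UNIV :: (real^'n::_) set)"
  interpret M: finite_measure ?M by (rule finite_sphere_measure_UNIV)
  obtain C where C: "C > 0" "\<And>\<xi>. norm \<xi> = 1 \<Longrightarrow> \<bar>h \<xi>\<bar> \<le> C"
    using sphere_bounded_obtain[OF h] by blast
  obtain K where K: "K > 0" "\<And>n. norm (X n) \<le> K"
    using convergent_imp_Bseq[OF convergentI[OF X]] by (auto simp: Bseq_def)
  have hm [measurable]: "h \<in> borel_measurable ?M"
    by (rule borel_measurable_sphere[OF borel_measurable_continuous_on_restrict[OF h]])
  have im [measurable]: "(\<lambda>\<xi>. w \<bullet> \<xi>) \<in> borel_measurable ?M" for w
    by (intro borel_measurable_sphere borel_measurable_continuous_on_restrict continuous_intros)
  show "(\<lambda>n. \<integral>\<xi>. (X n \<bullet> \<xi>) ^ m * sgn (X n \<bullet> \<xi>) * h \<xi> \<partial>?M) \<longlonglongrightarrow>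
      (\<integral>\<xi>. (x \<bullet> \<xi>) ^ m * sgn (x \<bullet> \<xi>) * h \<xi> \<partial>?M)"
  proof (rule integral_dominated_convergence[where w="\<lambda>_. K ^ m * 1 * C"])
    show "AE \<xi> in ?M. norm ((X n \<bullet> \<xi>) ^ m * sgn (X n \<bullet> \<xi>) * h \<xi>) \<le> K ^ m * 1 * C" for n
    proof (rule AE_I2)
      fix \<xi> assume "\<xi> \<in> space ?M"
      then have \<xi>: "norm \<xi> = 1" by simp
      have "\<bar>X n \<bullet> \<xi>\<bar> \<le> K"
        using Cauchy_Schwarz_ineq2[of "X n" \<xi>] K(2)[of n] \<xi> by simp
      then have "\<bar>X n \<bullet> \<xi>\<bar> ^ m * \<bar>sgn (X n \<bullet> \<xi>)\<bar> * \<bar>h \<xi>\<bar> \<le> K ^ m * 1 * C"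
        using K(1) C(2)[OF \<xi>] by (intro mult_mono power_mono) (auto simp: sgn_if)
      then show "norm ((X n \<bullet> \<xi>) ^ m * sgn (X n \<bullet> \<xi>) * h \<xi>) \<le> K ^ m * 1 * C"
        by (simp only: abs_mult power_abs real_norm_def)
    qed
    show "AE \<xi> in ?M. (\<lambda>n. (X n \<bullet> \<xi>) ^ m * sgn (X n \<bullet> \<xi>) * h \<xi>) \<longlonglongrightarrow> (x \<bullet> \<xi>) ^ m * sgn (x \<bullet> \<xi>) * h \<xi>"
      using AE_sphere_measure_inner_nonzero[of x] x
      by (auto elim!: eventually_mono intro!: tendsto_intros X)
  qed measurable
qed

section \<open>Half turns and continuity of equatorial integrals\<close>

text \<open>Twice the projection to the axis minus the identity: \<open>w\<close> is fixed and its
  orthogonal complement is negated. This gives an orthogonal map between two prescribed unit vectors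
  that depends continuously on them.\<close>

definition half_turn :: "'a::real_inner \<Rightarrow> 'a \<Rightarrow> 'a" where
  "half_turn w y = (2 * (y \<bullet> w) / (w \<bullet> w)) *\<^sub>R w - y"

lemma orthogonal_transformation_half_turn:
  assumes w: "w \<noteq> 0"
  shows "orthogonal_transformation (half_turn w)"
proof -
  have "linear (half_turn w)"
    by (rule linearI) (auto simp: half_turn_def inner_simps algebra_simps add_divide_distrib)
  moreover have "half_turn w x \<bullet> half_turn w y = x \<bullet> y" for x y
  proof -
    define c where "c = w \<bullet> w"
    have c: "2 * b / c * c = 2 * b" for b using w by (simp add: c_def)
    have "(a *\<^sub>R w - x) \<bullet> (b *\<^sub>R w - y) = a * (b * c) - a * (w \<bullet> y) - b * (w \<bullet> x) + x \<bullet> y" for a b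
      by (simp add: inner_diff_left inner_diff_right c_def inner_commute[of x w] right_diff_distrib)
    then have "half_turn w x \<bullet> half_turn w y = 2 * (x \<bullet> w) / c * (2 * (y \<bullet> w) / c * c)
        - 2 * (x \<bullet> w) / c * (w \<bullet> y) - 2 * (y \<bullet> w) / c * (w \<bullet> x) + x \<bullet> y"
      unfolding half_turn_def c_def[symmetric] .
    also have "\<dots> = x \<bullet> y" unfolding c by (simp add: inner_commute)
    finally show ?thesis .
  qed
  ultimately show ?thesis by (simp add: orthogonal_transformation_def)
qed

text \<open>For unit vectors the projection of \<open>a\<close> to the line of \<open>a + b\<close>
  is the midpoint of \<open>a\<close> and \<open>b\<close>, so doubling it and subtracting
  \<open>a\<close> leaves \<open>b\<close>.\<close>

lemma half_turn_add:
  assumes a: "norm a = 1" and b: "norm b = 1" and ab: "a + b \<noteq> 0"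
  shows "half_turn (a + b) a = b"
proof -
  have "a \<bullet> a = 1" "b \<bullet> b = 1" using a b by (auto simp: dot_square_norm)
  then have "2 * (a \<bullet> (a + b)) = (a + b) \<bullet> (a + b)"
    by (simp add: inner_simps inner_commute)
  then show ?thesis using ab by (simp add: half_turn_def)
qed

text \<open>\<open>R\<close> transports the hyperplane measure and preserves norms, hence it
  commutes with normalization in the cone formula on both sides.\<close>

lemma integral_sphere_measure_orthogonal:
  fixes R :: "real^'n::{finite,wellorder} \<Rightarrow> real^'n::_" and h :: "real^'n::_ \<Rightarrow> real"
  assumes u: "norm u = 1" and R: "orthogonal_transformation R" and h: "continuous_on (sphere 0 1) h"
  shows "(\<integral>\<xi>. h \<xi> \<partial>sphere_measure {y. R u \<bullet> y = 0}) = (\<integral>\<xi>. h (R \<xi>) \<partial>sphere_measure {y. u \<bullet> y = 0})"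
proof -
  have lin: "linear R" using R by (rule orthogonal_transformation_linear)
  have nR: "norm (R z) = norm z" for z using R by (simp add: orthogonal_transformation_norm)
  have Rc: "continuous_on S R" for S
    by (intro linear_continuous_on linear_linear[THEN iffD2] lin)
  then have [measurable]: "R \<in> borel_measurable borel"
    by (intro borel_measurable_continuous_onI)
  have hR: "continuous_on (sphere 0 1) (\<lambda>\<xi>. h (R \<xi>))"
    by (rule continuous_on_compose2[OF h Rc]) (auto simp: nR)
  note hm = borel_measurable_continuous_on_restrict[OF h] borel_measurable_continuous_on_restrict[OF hR]
  have dim: "dim {y. R u \<bullet> y = 0} = dim {y. u \<bullet> y = 0}"
    using u nR[of u] by (metis dim_hyperplane norm_zero zero_neq_one)
  have R0: "R z = 0 \<longleftrightarrow> z = 0" for z using nR[of z] by auto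
  have "indicator (cball 0 1) (R z) * radial_ext h (R z) = indicator (cball 0 1) z * radial_ext (\<lambda>\<xi>. h (R \<xi>)) z" for z
    by (simp add: radial_ext_def R0 sgn_div_norm linear_scale[OF lin] nR indicator_def)
  then show ?thesis
    using borel_measurable_cball_radial_ext[OF hm(1)]
    by (simp add: integral_sphere_measure subspace_hyperplane hm dim distr_orthogonal_subspace_lborel[OF u R] integral_distr)
qed

text \<open>The domain varies with \<open>x\<close>, so half turns pull all integrals back to the
  fixed equator orthogonal to \<open>u\<close>. The moving point then enters only through the
  integrand, and dominated convergence applies.\<close>

lemma continuous_on_integral_sphere_hyperplane:
  fixes h :: "real^'n::{finite,wellorder} \<Rightarrow> real"
  assumes h: "continuous_on (sphere 0 1) h"
  shows "continuous_on (UNIV - {0}) (\<lambda>x. \<integral>\<xi>. h \<xi> \<partial>sphere_measure {y. x \<bullet> y = 0})"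
  unfolding continuous_on_sequentially comp_def
proof (intro allI ballI impI, elim conjE)
  fix X :: "nat \<Rightarrow> real^'n::_" and x
  assume x: "x \<in> UNIV - {0}" and X: "X \<longlonglongrightarrow> x" and Xn: "\<forall>n. X n \<in> UNIV - {0}"
  define u where "u = x /\<^sub>R norm x"
  have u: "norm u = 1" using x by (simp add: u_def)
  define w where "w n = u + X n /\<^sub>R norm (X n)" for n
  have w: "w \<longlonglongrightarrow> u + u"
    unfolding w_def u_def using x by (intro tendsto_intros X) auto
  have uu: "u + u \<noteq> 0" using u by (metis add_cancel_left_left norm_zero scaleR_2 scaleR_eq_0_iff zero_neq_numeral zero_neq_one)
  have "eventually (\<lambda>n. w n \<noteq> 0) sequentially"
    using tendsto_imp_eventually_ne[OF w uu] .
  \<comment> \<open>The axis \<open>w n\<close> would vanish if the direction of \<open>X n\<close>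
    were \<open>- u\<close>; near the limit this cannot occur.\<close>
  then obtain N where N: "\<And>n. n \<ge> N \<Longrightarrow> w n \<noteq> 0" by (auto simp: eventually_sequentially)
  let ?M = "sphere_measure {y. u \<bullet> y = 0}"
  interpret M: finite_measure ?M by (rule finite_sphere_measure_hyperplane[OF u])
  obtain C where C: "C > 0" "\<And>\<xi>. norm \<xi> = 1 \<Longrightarrow> \<bar>h \<xi>\<bar> \<le> C"
    using sphere_bounded_obtain[OF h] by blast
  have orth: "orthogonal_transformation (half_turn v)" if "v \<noteq> 0" for v :: "real^'n::_"
    using that by (rule orthogonal_transformation_half_turn)
  have norm_ht: "norm (half_turn v z) = norm z" if "v \<noteq> 0" for v z :: "real^'n::_"
    using orth[OF that] by (simp add: orthogonal_transformation_norm)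
  have eq: "(\<integral>\<xi>. h \<xi> \<partial>sphere_measure {y. z \<bullet> y = 0}) = (\<integral>\<xi>. h (half_turn (u + z /\<^sub>R norm z) \<xi>) \<partial>?M)"
    if z: "z \<noteq> 0" "u + z /\<^sub>R norm z \<noteq> 0" for z
  proof -
    have "{y. z \<bullet> y = 0} = {y. half_turn (u + z /\<^sub>R norm z) u \<bullet> y = 0}"
      using z by (subst half_turn_add[OF u]) auto
    then show ?thesis
      by (simp only: integral_sphere_measure_orthogonal[OF u orth[OF z(2)] h])
  qed
  have hm: "(\<lambda>\<xi>. h (half_turn v \<xi>)) \<in> borel_measurable ?M" if "v \<noteq> 0" for v
  proof (intro borel_measurable_sphere borel_measurable_continuous_on_restrict)
    have "continuous_on (sphere 0 1) (half_turn v)"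
      unfolding half_turn_def[abs_def] using that by (intro continuous_intros) auto
    then show "continuous_on (sphere 0 1) (\<lambda>\<xi>. h (half_turn v \<xi>))"
      by (rule continuous_on_compose2[OF h]) (auto simp: norm_ht[OF that])
  qed
  have "(\<lambda>n. \<integral>\<xi>. h (half_turn (w (n + N)) \<xi>) \<partial>?M) \<longlonglongrightarrow> (\<integral>\<xi>. h (half_turn (u + u) \<xi>) \<partial>?M)"
  proof (rule integral_dominated_convergence[where w="\<lambda>_. C"])
    show "AE \<xi> in ?M. norm (h (half_turn (w (n + N)) \<xi>)) \<le> C" for n
      using C(2) N[of "n + N"] by (intro AE_I2) (auto simp: norm_ht)
    show "AE \<xi> in ?M. (\<lambda>n. h (half_turn (w (n + N)) \<xi>)) \<longlonglongrightarrow> h (half_turn (u + u) \<xi>)"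
    proof (rule AE_I2)
      fix \<xi> assume "\<xi> \<in> space ?M"
      then have \<xi>: "norm \<xi> = 1" by simp
      have "(\<lambda>n. half_turn (w (n + N)) \<xi>) \<longlonglongrightarrow> half_turn (u + u) \<xi>"
        unfolding half_turn_def using uu
        by (intro tendsto_intros LIMSEQ_ignore_initial_segment[OF w]) auto
      moreover have "half_turn (u + u) \<xi> \<in> sphere 0 1"
        unfolding mem_sphere_0 norm_ht[OF uu] by (rule \<xi>)
      moreover have "half_turn (w (n + N)) \<xi> \<in> sphere 0 1" for n
        unfolding mem_sphere_0 norm_ht[OF N, OF le_add2] by (rule \<xi>)
      ultimately show "(\<lambda>n. h (half_turn (w (n + N)) \<xi>)) \<longlonglongrightarrow> h (half_turn (u + u) \<xi>)"
        by (intro continuous_on_tendsto_compose[OF h] always_eventually) auto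
    qed
  qed (use hm uu N in auto)
  moreover have "(\<integral>\<xi>. h \<xi> \<partial>sphere_measure {y. X (n + N) \<bullet> y = 0}) = (\<integral>\<xi>. h (half_turn (w (n + N)) \<xi>) \<partial>?M)" for n
    using Xn N[of "n + N"] by (auto simp: eq w_def)
  \<comment> \<open>The limit is an instance of the same formula: the half turn about
    \<open>u + u\<close> fixes \<open>u\<close> and so maps its equator onto itself.\<close>
  moreover have "(\<integral>\<xi>. h \<xi> \<partial>sphere_measure {y. x \<bullet> y = 0}) = (\<integral>\<xi>. h (half_turn (u + u) \<xi>) \<partial>?M)"
    using x uu eq[of x] by (simp add: u_def[symmetric])
  ultimately have "(\<lambda>n. \<integral>\<xi>. h \<xi> \<partial>sphere_measure {y. X (n + N) \<bullet> y = 0}) \<longlonglongrightarrow>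
      (\<integral>\<xi>. h \<xi> \<partial>sphere_measure {y. x \<bullet> y = 0})" by simp
  then show "(\<lambda>n. \<integral>\<xi>. h \<xi> \<partial>sphere_measure {y. X n \<bullet> y = 0}) \<longlonglongrightarrow>
      (\<integral>\<xi>. h \<xi> \<partial>sphere_measure {y. x \<bullet> y = 0})" by (rule LIMSEQ_offset)
qed

section \<open>Higher derivatives\<close>

text \<open>Normalized so that \<open>\<partial>\<^sub>i\<close> lowers the index by one and multiplies \<open>h\<close> by \<open>\<xi>\<^sub>i\<close>; index \<open>m + 1\<close>
  carries the kernel \<open>s\<^sup>m sgn s / m!\<close>, and index \<open>0\<close> its last derivative, twice the delta function.\<close>

primrec power_sgn_transform :: "nat \<Rightarrow> (real^'n::{finite,wellorder} \<Rightarrow> real) \<Rightarrow> real^'n::_ \<Rightarrow> real" where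
  "power_sgn_transform 0 h x = 2 / norm x * (\<integral>\<xi>. h \<xi> \<partial>sphere_measure {y. x \<bullet> y = 0})"
| "power_sgn_transform (Suc m) h x =
    (\<integral>\<xi>. (x \<bullet> \<xi>) ^ m * sgn (x \<bullet> \<xi>) * h \<xi> \<partial>sphere_measure UNIV) / fact m"

lemma continuous_on_power_sgn_transform:
  assumes h: "continuous_on (sphere 0 1) h"
  shows "continuous_on (UNIV - {0}) (power_sgn_transform j h)"
proof (cases j)
  case 0
  then show ?thesis
    unfolding 0 power_sgn_transform.simps
    by (intro continuous_intros continuous_on_integral_sphere_hyperplane h) auto
next
  case (Suc m)
  then show ?thesis
    unfolding Suc power_sgn_transform.simps
    by (intro continuous_intros continuous_on_integral_power_sgn_sphere h) auto
qed

text \<open>The step from index 1 to index 0 is the singular one, localizing on the equator; in all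
  others the factor \<open>Suc m\<close> from the kernel cancels against
  \<open>fact (Suc m)\<close>.\<close>

lemma has_field_derivative_power_sgn_transform:
  assumes x: "x \<noteq> 0" and h: "continuous_on (sphere 0 1) h"
  shows "((\<lambda>t. power_sgn_transform (Suc j) h (x + t *\<^sub>R axis i 1)) has_field_derivative
    power_sgn_transform j (\<lambda>\<xi>. \<xi> $ i * h \<xi>) x) (at 0)"
proof (cases j)
  case 0
  then show ?thesis
    using has_field_derivative_integral_sgn_sphere[OF x h, of "axis i 1"] by (simp add: inner_axis')
next
  case (Suc m)
  then show ?thesis
    using DERIV_cdivide[OF has_field_derivative_integral_power_sgn_sphere[OF x h, where m=m and v="axis i 1"], of "fact (Suc m)"]
    by (simp add: inner_axis' mult_ac)
qed

section \<open>Partial derivatives and \<open>Cm_on\<close> depend only on local values\<close>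

lemma eventually_axis_in_open:
  fixes x :: "real^'n"
  assumes "open U" "x \<in> U"
  shows "eventually (\<lambda>t. x + t *\<^sub>R axis i 1 \<in> U) (nhds 0)"
  unfolding eventually_nhds
proof (intro exI conjI)
  show "open ((\<lambda>t. x + t *\<^sub>R axis i 1) -` U)"
    by (intro open_vimage assms continuous_intros)
qed (use assms in auto)

lemma partial_deriv_cong:
  assumes U: "open U" and x: "x \<in> U" and eq: "\<And>y. y \<in> U \<Longrightarrow> g y = g' y"
  shows "partial_deriv i g x = partial_deriv i g' x"
  unfolding partial_deriv_def
  by (rule deriv_cong_ev[OF eventually_mono[OF eventually_axis_in_open[OF U x]] refl]) (rule eq)

text \<open>Agreement on an open set passes to partial derivatives, so the induction varies both
  functions. It is used because the derivative formulas hold only away from the origin.\<close>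

lemma Cm_on_cong:
  assumes U: "open U" and eq: "\<And>y. y \<in> U \<Longrightarrow> g y = g' y" and g: "Cm_on m U g"
  shows "Cm_on m U g'"
  using eq g
proof (induction m arbitrary: g g')
  case 0
  then show ?case using continuous_on_eq by auto
next
  case (Suc m)
  have "continuous_on U g'"
    by (rule continuous_on_eq[of U g]) (use Suc.prems in auto)
  moreover have "(\<lambda>t. g' (x + t *\<^sub>R axis i 1)) field_differentiable at 0" if x: "x \<in> U" for x i
  proof -
    have ev: "eventually (\<lambda>t. g (x + t *\<^sub>R axis i 1) = g' (x + t *\<^sub>R axis i 1)) (nhds 0)"
      using eventually_axis_in_open[OF U x] by eventually_elim (rule Suc.prems(1))
    have "(\<lambda>t. g (x + t *\<^sub>R axis i 1)) field_differentiable at 0"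
      using Suc.prems(2) x by auto
    then show ?thesis
      unfolding field_differentiable_def using DERIV_cong_ev[OF refl ev refl] by auto
  qed
  moreover have "Cm_on m U (partial_deriv i g')" for i
  proof (rule Suc.IH[of "partial_deriv i g"])
    show "partial_deriv i g y = partial_deriv i g' y" if "y \<in> U" for y
      using that Suc.prems(1) by (rule partial_deriv_cong[OF U])
  qed (use Suc.prems(2) in simp)
  ultimately show ?case by simp
qed

lemma partial_deriv_power_sgn_transform:
  assumes "x \<noteq> 0" and "continuous_on (sphere 0 1) h"
  shows "partial_deriv i (power_sgn_transform (Suc j) h) x = power_sgn_transform j (\<lambda>\<xi>. \<xi> $ i * h \<xi>) x"
  unfolding partial_deriv_def by (rule DERIV_imp_deriv[OF has_field_derivative_power_sgn_transform[OF assms]])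

text \<open>Each partial derivative lowers the index by one and multiplies \<open>h\<close> by a
  coordinate, whence the induction over all continuous \<open>h\<close>; continuity holds down to
  index 0.\<close>

lemma Cm_on_power_sgn_transform:
  assumes "continuous_on (sphere 0 1) h"
  shows "Cm_on j (UNIV - {0}) (power_sgn_transform j h)"
  using assms
proof (induction j arbitrary: h)
  case 0
  then show ?case by (simp add: continuous_on_power_sgn_transform del: power_sgn_transform.simps)
next
  case (Suc j)
  have "Cm_on j (UNIV - {0}) (partial_deriv i (power_sgn_transform (Suc j) h))" for i
  proof (rule Cm_on_cong)
    show "Cm_on j (UNIV - {0}) (power_sgn_transform j (\<lambda>\<xi>. \<xi> $ i * h \<xi>))"
      using Suc.prems by (intro Suc.IH continuous_intros)
  qed (use Suc.prems partial_deriv_power_sgn_transform[symmetric] in \<open>auto simp del: power_sgn_transform.simps\<close>)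
  then show ?case
    using continuous_on_power_sgn_transform[OF Suc.prems] has_field_derivative_power_sgn_transform[OF _ Suc.prems]
    unfolding Cm_on.simps field_differentiable_def by blast
qed

text \<open>Stated for any \<open>g\<close> that agrees with a transform off the origin, because the
  result of earlier derivatives is a transform only there.\<close>

lemma partial_deriv_funpow_power_sgn_transform:
  assumes h: "continuous_on (sphere 0 1) h" and eq: "\<And>y. y \<noteq> 0 \<Longrightarrow> g y = power_sgn_transform (m + a) h y"
    and x: "x \<noteq> 0"
  shows "(partial_deriv i ^^ a) g x = power_sgn_transform m (\<lambda>\<xi>. (\<xi> $ i) ^ a * h \<xi>) x"
  using eq x
proof (induction a arbitrary: m x)
  case 0
  then show ?case by simp
next
  case (Suc a)
  have "partial_deriv i ((partial_deriv i ^^ a) g) x =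
      partial_deriv i (power_sgn_transform (Suc m) (\<lambda>\<xi>. (\<xi> $ i) ^ a * h \<xi>)) x"
    by (rule partial_deriv_cong[of "UNIV - {0}"]) (use Suc in \<open>auto simp del: power_sgn_transform.simps\<close>)
  also have "\<dots> = power_sgn_transform m (\<lambda>\<xi>. \<xi> $ i * ((\<xi> $ i) ^ a * h \<xi>)) x"
    using Suc.prems h by (intro partial_deriv_power_sgn_transform continuous_intros)
  finally show ?case by (simp add: mult_ac)
qed

lemma foldr_partial_deriv_power_sgn_transform:
  fixes h :: "real^'n::{finite,wellorder} \<Rightarrow> real"
  assumes h: "continuous_on (sphere 0 1) h" and x: "x \<noteq> 0"
  shows "foldr (\<lambda>i. partial_deriv i ^^ \<alpha> i) is (power_sgn_transform (m + sum_list (map \<alpha> is)) h) x =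
    power_sgn_transform m (\<lambda>\<xi>. prod_list (map (\<lambda>i. (\<xi> $ i) ^ \<alpha> i) is) * h \<xi>) x"
  using x
proof (induction "is" arbitrary: m x)
  case Nil
  then show ?case by simp
next
  case (Cons i "is")
  have c: "continuous_on (sphere 0 1) (\<lambda>\<xi>. prod_list (map (\<lambda>i. (\<xi> $ i) ^ \<alpha> i) is) * h \<xi>)"
    by (induction "is") (auto intro!: continuous_intros h simp: mult.assoc)
  show ?case
    \<comment> \<open>The tail of the list is differentiated first, so the induction hypothesis is
      taken at \<open>m + \<alpha> i\<close>, leaving \<open>\<alpha> i\<close> levels for the
      head.\<close>
    using partial_deriv_funpow_power_sgn_transform[OF c _ Cons.prems, of _ m "\<alpha> i" i] Cons.IH[of _ "m + \<alpha> i"]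
    by (simp add: add.assoc mult.assoc del: power_sgn_transform.simps)
qed

lemma multi_deriv_power_sgn_transform:
  fixes h :: "real^'n::{finite,wellorder} \<Rightarrow> real"
  assumes h: "continuous_on (sphere 0 1) h" and x: "x \<noteq> 0"
  shows "multi_deriv \<alpha> (power_sgn_transform (\<Sum>i\<in>UNIV. \<alpha> i) h) x =
    power_sgn_transform 0 (\<lambda>\<xi>. (\<Prod>i\<in>UNIV. (\<xi> $ i) ^ \<alpha> i) * h \<xi>) x"
proof -
  have "(\<Sum>i\<in>UNIV. \<alpha> i) = 0 + sum_list (map \<alpha> (sorted_list_of_set UNIV))"
    by (simp add: sum_list_distinct_conv_sum_set)
  moreover have "(\<Prod>i\<in>UNIV. (\<xi> $ i) ^ \<alpha> i) = prod_list (map (\<lambda>i. (\<xi> $ i) ^ \<alpha> i) (sorted_list_of_set UNIV))"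
    for \<xi> :: "real^'n::_"
    by (simp flip: prod.distinct_set_conv_list)
  ultimately show ?thesis
    unfolding multi_deriv_def by (simp only: foldr_partial_deriv_power_sgn_transform[OF h x])
qed

section \<open>The value of the constant\<close>

lemma neg_half_notin_nonpos_Ints: "- (real k + 1 / 2) \<notin> \<int>\<^sub>\<le>\<^sub>0"
proof
  assume "- (real k + 1 / 2) \<in> \<int>\<^sub>\<le>\<^sub>0"
  then obtain n where "- (real k + 1 / 2) = real_of_int n" by (auto elim!: nonpos_Ints_cases)
  then have "real_of_int (2 * int k + 1) = real_of_int (- 2 * n)" by simp
  then have "2 * int k + 1 = - 2 * n" by (simp only: of_int_eq_iff)
  then show False by presburger
qed

text \<open>Descending from \<open>Gamma (1 / 2) = sqrt pi\<close> by the functional equation;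
  passing from \<open>k\<close> to \<open>Suc k\<close> multiplies both sides by
  \<open>- 4 * real (Suc k)\<close>. The identity is kept free of denominators for the
  induction.\<close>

lemma Gamma_neg_half:
  "2 ^ (2 * k + 2) * sqrt pi * fact k * (- 1) ^ (k + 1) = 2 * fact (2 * k + 1) * Gamma (- (real k + 1 / 2))"
proof (induction k)
  case 0
  have "Gamma (- (1 / 2) + 1) = - (1 / 2) * Gamma (- (1 / 2) :: real)"
    using Gamma_plus1[OF neg_half_notin_nonpos_Ints[of 0]] by simp
  then show ?case by (simp add: Gamma_one_half_real)
next
  case (Suc k)
  from Gamma_plus1[OF neg_half_notin_nonpos_Ints[of "Suc k"]]
  have G: "Gamma (- (real k + 1 / 2)) = - (real k + 3 / 2) * Gamma (- (real (Suc k) + 1 / 2))"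
    by (simp add: algebra_simps)
  have "2 ^ (2 * Suc k + 2) * sqrt pi * fact (Suc k) * (- 1) ^ (Suc k + 1) =
      - 4 * real (Suc k) * (2 ^ (2 * k + 2) * sqrt pi * fact k * (- 1) ^ (k + 1))"
    by (simp add: algebra_simps)
  also have "\<dots> = 2 * fact (2 * Suc k + 1) * Gamma (- (real (Suc k) + 1 / 2))"
  proof -
    have F: "fact (2 * Suc k + 1) = (2 * real k + 3) * (2 * real k + 2) * fact (2 * k + 1)"
      by (simp add: algebra_simps)
    have "- 4 * real (Suc k) * (2 * b * (- (real k + 3 / 2) * c)) = 2 * ((2 * real k + 3) * (2 * real k + 2) * b) * c"
      for b c :: real by (simp add: algebra_simps)
    then show ?thesis unfolding Suc.IH G F .
  qed
  finally show ?case .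
qed

text \<open>The value matches the analysis: 2 is the jump of the sign function and the factorial
  comes from differentiating the power \<open>2 * k + 1\<close> times.\<close>

lemma C_const_odd:
  "C_const (real (2 * k + 1)) * (- 1) ^ (k + 1) = 2 * fact (2 * k + 1)"
proof -
  \<comment> \<open>The identity of the preceding lemma shows this by itself, its left-hand side
    being nonzero.\<close>
  have "Gamma (- (real k + 1 / 2)) \<noteq> 0"
  proof
    assume "Gamma (- (real k + 1 / 2)) = 0"
    with Gamma_neg_half[of k] show False by simp
  qed
  moreover have "C_const (real (2 * k + 1)) = 2 ^ (2 * k + 2) * sqrt pi * fact k / Gamma (- (real k + 1 / 2))"
  proof -
    have "2 powr (real (2 * k + 1) + 1) = (2 ^ (2 * k + 2) :: real)"
      by (subst powr_realpow[symmetric]) (simp_all add: add_ac)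
    moreover have "Gamma ((real (2 * k + 1) + 1) / 2) = fact k"
    proof -
      have "(real (2 * k + 1) + 1) / 2 = 1 + real k" by simp
      then show ?thesis by (simp only: Gamma_fact)
    qed
    moreover have "- real (2 * k + 1) / 2 = - (real k + 1 / 2)" by (simp add: field_simps)
    ultimately show ?thesis unfolding C_const_def by (simp only:)
  qed
  moreover have "a / c * s = 2 * b" if "c \<noteq> 0" "a * s = 2 * b * c" for a b c s :: real
    using that by (simp add: field_simps)
  ultimately show ?thesis using Gamma_neg_half[of k] by metis
qed

theorem theorem2p1:
  fixes k :: nat
    and f H :: "real^'n::{finite,wellorder} \<Rightarrow> real"
  assumes n: "CARD('n) \<ge> 2"
    and f_cont: "continuous_on (sphere 0 1) f"
    and f_even: "\<forall>\<xi>\<in>sphere 0 1. f (- \<xi>) = f \<xi>"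
    and H: "\<forall>x. H x = (\<integral>\<xi>. \<bar>x \<bullet> \<xi>\<bar> ^ (2 * k + 1) * f \<xi> \<partial>sphere_measure UNIV)"
  shows "Cm_on (2 * k + 2) (UNIV - {0}) H \<and>
    (\<forall>\<alpha> :: 'n \<Rightarrow> nat. (\<Sum>i\<in>UNIV. \<alpha> i) = 2 * k + 2 \<longrightarrow>
      (\<forall>x. x \<noteq> 0 \<longrightarrow>
        multi_deriv \<alpha> H x =
          C_const (real (2 * k + 1)) * ((-1) ^ (k + 1) / norm x) *
          (\<integral>\<xi>. (\<Prod>i\<in>UNIV. (\<xi> $ i) ^ \<alpha> i) * f \<xi> \<partial>sphere_measure {y. x \<bullet> y = 0})))"
proof -
  \<comment> \<open>The factorial undoes the normalization of \<open>power_sgn_transform\<close>, so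
    that \<open>H\<close> itself is the transform of index \<open>2 * k + 2\<close>.\<close>
  define h where "h \<xi> = fact (2 * k + 1) * f \<xi>" for \<xi>
  have h: "continuous_on (sphere 0 1) h"
    unfolding h_def by (intro continuous_intros f_cont)
  \<comment> \<open>The exponent is odd, so the sign survives as one factor; at \<open>s = 0\<close>
    both sides vanish because the exponent is positive.\<close>
  have abs: "\<bar>s\<bar> ^ (2 * k + 1) = s ^ (2 * k + 1) * sgn s" for s :: real
    by (simp add: abs_sgn power_mult_distrib power_mult[symmetric] sgn_if)
  have H_eq: "H = power_sgn_transform (2 * k + 2) h"
  proof (intro ext)
    fix x
    have "power_sgn_transform (2 * k + 2) h x =
        (\<integral>\<xi>. fact (2 * k + 1) * (\<bar>x \<bullet> \<xi>\<bar> ^ (2 * k + 1) * f \<xi>) \<partial>sphere_measure UNIV) / fact (2 * k + 1)"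
      unfolding abs h_def by (simp only: power_sgn_transform.simps numeral_2_eq_2 add_Suc_right add_0_right mult_ac One_nat_def)
    also have "\<dots> = H x" using H by (simp del: fact_Suc)
    finally show "H x = power_sgn_transform (2 * k + 2) h x" ..
  qed
  have "multi_deriv \<alpha> H x = C_const (real (2 * k + 1)) * ((-1) ^ (k + 1) / norm x) *
      (\<integral>\<xi>. (\<Prod>i\<in>UNIV. (\<xi> $ i) ^ \<alpha> i) * f \<xi> \<partial>sphere_measure {y. x \<bullet> y = 0})"
    if "(\<Sum>i\<in>UNIV. \<alpha> i) = 2 * k + 2" "x \<noteq> 0" for \<alpha> and x :: "real^'n::_"
  proof -
    let ?I = "\<integral>\<xi>. (\<Prod>i\<in>UNIV. (\<xi> $ i) ^ \<alpha> i) * f \<xi> \<partial>sphere_measure {y. x \<bullet> y = 0}"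
    have "multi_deriv \<alpha> H x = power_sgn_transform 0 (\<lambda>\<xi>. (\<Prod>i\<in>UNIV. (\<xi> $ i) ^ \<alpha> i) * h \<xi>) x"
      using multi_deriv_power_sgn_transform[OF h that(2), of \<alpha>] by (simp only: H_eq that(1))
    also have "\<dots> = 2 * fact (2 * k + 1) / norm x * ?I"
      by (simp add: h_def mult.left_commute[of _ "fact _"] del: fact_Suc)
    finally show ?thesis by (simp only: C_const_odd[of k, symmetric] times_divide_eq_right)
  qed
  moreover have "Cm_on (2 * k + 2) (UNIV - {0}) H"
    unfolding H_eq by (rule Cm_on_power_sgn_transform[OF h])
  ultimately show ?thesis by blast
qed


end
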